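(* Let $\gamma>0$ and let $\mu$ be a distribution on $\mathbb{R}$ such that the function $x\mapsto e^{\gamma x}\bar\mu(x)$ belongs to $\mathbf{M}$. If $\mu^{n*}\in\mathcal{S}(\gamma)$ for some $n\in\mathbb{N}$, then $\mu\in\mathcal{S}(\gamma)$.
   Context: For a probability distribution $\rho$ on $\mathbb{R}$: $\bar\rho(x):=\rho((x,\infty))$, $\rho^{n*}$ is the $n$-th convolution power, $\widehat\rho(\gamma):=\int e^{\gamma x}\rho(dx)$. $f\sim g$ means $f(x)/g(x)\to1$ as $x\to\infty$. For $\gamma\ge0$: $\rho\in\mathcal{L}(\gamma)$ if $\bar\rho(x)>0$ for all $x$ and $\bar\rho(x+a)\sim e^{-\gamma a}\bar\rho(x)$ for every $a\in\mathbb{R}$; $\rho\in\mathcal{S}(\gamma)$ if $\rho\in\mathcal{L}(\gamma)$, $\widehat\rho(\gamma)<\infty$ and $\overline{\rho^{2*}}(x)\sim2\widehat\rho(\gamma)\bar\rho(x)$. A nonnegative measurable function $g$ on $\mathbb{R}$ is in $\mathbf{L}$ if $g(x)>0$ for all sufficiently large $x$ and $g(x+a)\sim g(x)$ for every $a\in\mathbb{R}$. A nonnegative measurable function $g$ on $\mathbb{R}$ is in $\mathbf{M}$ if $g(x)>0$ for all sufficiently large $x$ and there exist $a\in[0,1]$, $f_1\in\mathbf{L}$, and a positive, (weakly) decreasing function $f_2$ on $\mathbb{R}$ such that $g(x)\sim af_1(x)+(1-a)f_2(x)$. *)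

theory Defs
  imports "HOL-Probability.Probability"
begin

definition tail :: "real measure \<Rightarrow> real \<Rightarrow> real" where
  "tail \<rho> x = measure \<rho> {x<..}"

fun conv_pow :: "real measure \<Rightarrow> nat \<Rightarrow> real measure" where
  "conv_pow \<rho> 0 = return borel 0"
| "conv_pow \<rho> (Suc n) = convolution \<rho> (conv_pow \<rho> n)"

text \<open>Moment generating function hat rho(gamma) = integral of e^(gamma x), as an extended
  nonnegative real (so finiteness is expressible).\<close>
definition mgf :: "real measure \<Rightarrow> real \<Rightarrow> ennreal" where
  "mgf \<rho> \<gamma> = (\<integral>\<^sup>+ x. ennreal (exp (\<gamma> * x)) \<partial>\<rho>)"

definition asymp_eq_top :: "(real \<Rightarrow> real) \<Rightarrow> (real \<Rightarrow> real) \<Rightarrow> bool" where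
  "asymp_eq_top f g \<longleftrightarrow> ((\<lambda>x. f x / g x) \<longlongrightarrow> 1) at_top"

definition class_L :: "real \<Rightarrow> real measure \<Rightarrow> bool" where
  "class_L \<gamma> \<rho> \<longleftrightarrow> (\<forall>x. tail \<rho> x > 0) \<and>
     (\<forall>a. asymp_eq_top (\<lambda>x. tail \<rho> (x + a)) (\<lambda>x. exp (- \<gamma> * a) * tail \<rho> x))"

definition class_S :: "real \<Rightarrow> real measure \<Rightarrow> bool" where
  "class_S \<gamma> \<rho> \<longleftrightarrow> class_L \<gamma> \<rho> \<and> mgf \<rho> \<gamma> < \<infinity> \<and>
     asymp_eq_top (tail (conv_pow \<rho> 2)) (\<lambda>x. 2 * enn2real (mgf \<rho> \<gamma>) * tail \<rho> x)"

definition fun_L :: "(real \<Rightarrow> real) \<Rightarrow> bool" where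
  "fun_L g \<longleftrightarrow> (\<forall>x. g x \<ge> 0) \<and> g \<in> borel_measurable borel \<and>
     (\<forall>\<^sub>F x in at_top. g x > 0) \<and> (\<forall>a. asymp_eq_top (\<lambda>x. g (x + a)) g)"

definition fun_M :: "(real \<Rightarrow> real) \<Rightarrow> bool" where
  "fun_M g \<longleftrightarrow> (\<forall>x. g x \<ge> 0) \<and> g \<in> borel_measurable borel \<and>
     (\<forall>\<^sub>F x in at_top. g x > 0) \<and>
     (\<exists>a f1 f2. 0 \<le> a \<and> a \<le> 1 \<and> fun_L f1 \<and> (\<forall>x. f2 x > 0) \<and> antimono f2 \<and>
        asymp_eq_top g (\<lambda>x. a * f1 x + (1 - a) * f2 x))"

end

theory Submission
  imports Defs
begin

text \<open>
  Put \<open>\<rho> = \<mu>\<^sup>n\<^sup>*\<close>, \<open>M\<close> for the moment \<open>\<integral>e\<^sup>\<gamma>\<^sup>x d\<mu>\<close> and \<open>W = tail \<mu> / tail \<rho>\<close>.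
  The function \<open>W\<close> is bounded, and \<open>fun_M\<close> for \<open>e\<^sup>\<gamma>\<^sup>x tail \<mu>(x)\<close> is used only through the
  fact that this function is asymptotically decreasing along every fixed shift.
  Suppose \<open>W(t\<^sub>j)\<close> tends to \<open>w\<close> along some sequence. Asymptotic monotonicity bounds
  \<open>W\<close> asymptotically from below by \<open>w\<close> at bounded distance to the left of \<open>t\<^sub>j\<close>, and from above
  by \<open>w\<close> to the right. In a convolution of measures dominated by \<open>\<rho>\<close>, the contribution of
  two large summands is negligible by convolution equivalence of \<open>\<rho>\<close>, so Fatou's lemma carries both
  bounds through the convolution powers of \<open>\<mu>\<close>, at the price of enlarging the shift.
  For the \<open>n\<close>-th power they say \<open>w n M\<^sup>n\<^sup>-\<^sup>1 \<le> 1\<close> and \<open>w n M\<^sup>n\<^sup>-\<^sup>1 \<ge> 1\<close>.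
  Hence \<open>W\<close> converges to a positive constant, and tail equivalence with \<open>\<rho>\<close> gives the claim.
\<close>

section \<open>Tails and convolutions\<close>

lemma tail_nonneg: "0 \<le> tail \<sigma> x"
  by (simp add: tail_def)

lemma tail_le_1: "real_distribution \<sigma> \<Longrightarrow> tail \<sigma> x \<le> 1"
  unfolding tail_def real_distribution_def by (auto intro: prob_space.prob_le_1)

lemma tail_antimono:
  assumes "real_distribution \<sigma>" "x \<le> y"
  shows "tail \<sigma> y \<le> tail \<sigma> x"
proof -
  interpret real_distribution \<sigma> by fact
  show ?thesis
    unfolding tail_def using assms(2) by (intro finite_measure_mono) auto
qed

lemma tail_measurable:
  assumes "real_distribution \<sigma>"
  shows "tail \<sigma> \<in> borel_measurable borel"
proof -
  have "mono (\<lambda>x. - tail \<sigma> x)"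
    using tail_antimono[OF assms] by (simp add: mono_def)
  then have "(\<lambda>x. - tail \<sigma> x) \<in> borel_measurable borel"
    by (rule borel_measurable_mono)
  then show ?thesis by simp
qed

lemma real_distribution_convolution:
  assumes "real_distribution \<sigma>" "real_distribution \<tau>"
  shows "real_distribution (\<sigma> \<star> \<tau>)"
proof -
  interpret S: real_distribution \<sigma> by fact
  interpret T: real_distribution \<tau> by fact
  interpret pair_prob_space \<sigma> \<tau> ..
  show ?thesis
    unfolding convolution_def by (intro real_distribution_distr) simp
qed

lemma real_distribution_conv_pow:
  assumes "real_distribution \<sigma>"
  shows "real_distribution (conv_pow \<sigma> k)"
proof (induction k)
  case 0
  show ?case
    by (auto simp: real_distribution_def real_distribution_axioms_def intro: prob_space_return)
qed (simp add: real_distribution_convolution assms)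

lemma convolution_comm:
  assumes "real_distribution \<sigma>" "real_distribution \<tau>"
  shows "(\<sigma> \<star> \<tau>) = (\<tau> \<star> \<sigma>)"
proof -
  interpret S: real_distribution \<sigma> by fact
  interpret T: real_distribution \<tau> by fact
  show ?thesis
    by (rule convolution_commutative) (simp_all add: S.finite_measure_axioms T.finite_measure_axioms)
qed

lemma convolution_return_0:
  assumes "real_distribution \<sigma>"
  shows "(\<sigma> \<star> return borel 0) = \<sigma>"
proof (rule measure_eqI)
  interpret S: real_distribution \<sigma> by fact
  show "sets (\<sigma> \<star> return borel 0) = sets \<sigma>" by simp
  fix A assume "A \<in> sets (\<sigma> \<star> return borel 0)"
  then have A[measurable]: "A \<in> sets borel" by simp
  have "emeasure (\<sigma> \<star> return borel 0) A = (\<integral>\<^sup>+x. indicator A x \<partial>\<sigma>)"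
    by (subst convolution_emeasure')
      (auto simp: S.finite_measure_axioms nn_integral_return
         intro!: prob_space.finite_measure prob_space_return)
  then show "emeasure (\<sigma> \<star> return borel 0) A = emeasure \<sigma> A" by simp
qed

lemma conv_pow_2: "real_distribution \<sigma> \<Longrightarrow> conv_pow \<sigma> 2 = (\<sigma> \<star> \<sigma>)"
  by (simp add: numeral_2_eq_2 convolution_return_0)

lemma integrable_exp_iff:
  assumes "real_distribution \<sigma>"
  shows "integrable \<sigma> (\<lambda>x. exp (\<gamma> * x)) \<longleftrightarrow> mgf \<sigma> \<gamma> < \<infinity>"
proof -
  interpret real_distribution \<sigma> by fact
  show ?thesis
    unfolding mgf_def integrable_iff_bounded by simp
qed

lemma mgf_eq_integral:
  assumes "integrable \<sigma> (\<lambda>x. exp (\<gamma> * x))"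
  shows "mgf \<sigma> \<gamma> = ennreal (\<integral>x. exp (\<gamma> * x) \<partial>\<sigma>)"
  unfolding mgf_def using assms by (intro nn_integral_eq_integral) auto

lemma mgf_convolution:
  assumes "real_distribution \<sigma>" "real_distribution \<tau>"
  shows "mgf (\<sigma> \<star> \<tau>) \<gamma> = mgf \<sigma> \<gamma> * mgf \<tau> \<gamma>"
proof -
  interpret S: real_distribution \<sigma> by fact
  interpret T: real_distribution \<tau> by fact
  have "mgf (\<sigma> \<star> \<tau>) \<gamma> = (\<integral>\<^sup>+x. \<integral>\<^sup>+y. ennreal (exp (\<gamma> * (x + y))) \<partial>\<tau> \<partial>\<sigma>)"
    unfolding mgf_def
    by (subst nn_integral_convolution) (simp_all add: S.finite_measure_axioms T.finite_measure_axioms)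
  also have "\<dots> = (\<integral>\<^sup>+x. \<integral>\<^sup>+y. ennreal (exp (\<gamma> * x)) * ennreal (exp (\<gamma> * y)) \<partial>\<tau> \<partial>\<sigma>)"
    by (simp add: distrib_left exp_add ennreal_mult')
  also have "\<dots> = (\<integral>\<^sup>+x. ennreal (exp (\<gamma> * x)) * mgf \<tau> \<gamma> \<partial>\<sigma>)"
    unfolding mgf_def by (subst nn_integral_cmult) simp_all
  also have "\<dots> = mgf \<sigma> \<gamma> * mgf \<tau> \<gamma>"
    unfolding mgf_def by (subst nn_integral_multc) simp_all
  finally show ?thesis .
qed

lemma mgf_conv_pow:
  assumes "real_distribution \<sigma>"
  shows "mgf (conv_pow \<sigma> k) \<gamma> = mgf \<sigma> \<gamma> ^ k"
proof (induction k)
  case 0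
  show ?case by (simp add: mgf_def nn_integral_return)
qed (simp add: mgf_convolution assms real_distribution_conv_pow)

lemma mgf_pos:
  assumes "real_distribution \<sigma>"
  shows "mgf \<sigma> \<gamma> > 0"
proof -
  interpret real_distribution \<sigma> by fact
  have "mgf \<sigma> \<gamma> \<noteq> 0"
    unfolding mgf_def by (subst nn_integral_0_iff_AE) (auto simp: ennreal_eq_0_iff not_le[symmetric] AE_False)
  then show ?thesis by (simp add: zero_less_iff_neq_zero)
qed

text \<open>For independent X and Y with laws \<sigma> and \<tau> this is the probability that X
  \<le> A and X + Y > x. As an integral over the small summand it is open to limit theorems.\<close>

definition conv_below :: "real measure \<Rightarrow> real measure \<Rightarrow> real \<Rightarrow> real \<Rightarrow> real" where
  "conv_below \<sigma> \<tau> A x = (\<integral>s. indicator {..A} s * tail \<tau> (x - s) \<partial>\<sigma>)"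

definition joint :: "real measure \<Rightarrow> real measure \<Rightarrow> real \<Rightarrow> real \<Rightarrow> real" where
  "joint \<sigma> \<tau> A x = measure (\<sigma> \<Otimes>\<^sub>M \<tau>) {p. A < fst p \<and> A < snd p \<and> x < fst p + snd p}"

lemma integrable_tail:
  assumes "real_distribution \<sigma>" "real_distribution \<tau>" "S \<in> sets borel"
    "f \<in> borel_measurable borel"
  shows "integrable \<sigma> (\<lambda>s. indicator S s * tail \<tau> (f s))"
proof -
  interpret S: real_distribution \<sigma> by fact
  note [measurable] = assms(3,4) tail_measurable[OF assms(2)]
  show ?thesis
    by (rule S.integrable_const_bound[where B=1])
      (auto split: split_indicator simp: tail_nonneg tail_le_1[OF assms(2)])
qed

text \<open>Fubini: the section of the event at s is empty or a half-line. Suitable S and f give the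
  full convolution tail, \<open>conv_below\<close> and \<open>joint\<close> from this one
  formula.\<close>

lemma measure_pair_tail:
  assumes "real_distribution \<sigma>" "real_distribution \<tau>"
    and [measurable]: "S \<in> sets borel" "f \<in> borel_measurable borel"
  shows "measure (\<sigma> \<Otimes>\<^sub>M \<tau>) {p. fst p \<in> S \<and> f (fst p) < snd p}
    = (\<integral>s. indicator S s * tail \<tau> (f s) \<partial>\<sigma>)"
proof -
  interpret S: real_distribution \<sigma> by fact
  interpret T: real_distribution \<tau> by fact
  interpret pair_prob_space \<sigma> \<tau> ..
  let ?A = "{p. fst p \<in> S \<and> f (fst p) < snd p}"
  have "Measurable.pred (\<sigma> \<Otimes>\<^sub>M \<tau>) (\<lambda>p. fst p \<in> S \<and> f (fst p) < snd p)"
    by measurable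
  then have A: "?A \<in> sets (\<sigma> \<Otimes>\<^sub>M \<tau>)"
    by (simp add: pred_def space_pair_measure)
  have "emeasure (\<sigma> \<Otimes>\<^sub>M \<tau>) ?A = (\<integral>\<^sup>+s. emeasure \<tau> (Pair s -` ?A) \<partial>\<sigma>)"
    by (rule T.emeasure_pair_measure_alt[OF A])
  also have "\<dots> = (\<integral>\<^sup>+s. ennreal (indicator S s * tail \<tau> (f s)) \<partial>\<sigma>)"
  proof (rule nn_integral_cong)
    fix s
    have "Pair s -` ?A = (if s \<in> S then {f s<..} else {})"
      by auto
    then show "emeasure \<tau> (Pair s -` ?A) = ennreal (indicator S s * tail \<tau> (f s))"
      by (simp add: tail_def T.emeasure_eq_measure)
  qed
  also have "\<dots> = ennreal (\<integral>s. indicator S s * tail \<tau> (f s) \<partial>\<sigma>)"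
    by (rule nn_integral_eq_integral) (auto simp: integrable_tail assms tail_nonneg)
  finally show ?thesis
    by (simp add: measure_def tail_nonneg)
qed

lemma measure_pair_swap:
  assumes "real_distribution \<sigma>" "real_distribution \<tau>" "Measurable.pred (borel \<Otimes>\<^sub>M borel) P"
  shows "measure (\<sigma> \<Otimes>\<^sub>M \<tau>) {p. P p} = measure (\<tau> \<Otimes>\<^sub>M \<sigma>) {p. P (snd p, fst p)}"
proof -
  interpret S: real_distribution \<sigma> by fact
  interpret T: real_distribution \<tau> by fact
  interpret pair_prob_space \<sigma> \<tau> ..
  have "sets (\<sigma> \<Otimes>\<^sub>M \<tau>) = sets (borel \<Otimes>\<^sub>M borel)"
    by (rule sets_pair_measure_cong) auto
  moreover have B: "{p. P p} \<in> sets (borel \<Otimes>\<^sub>M borel)"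
    using assms(3) by (simp add: pred_def space_pair_measure)
  ultimately have A: "{p. P p} \<in> sets (\<sigma> \<Otimes>\<^sub>M \<tau>)"
    by simp
  have "measure (\<sigma> \<Otimes>\<^sub>M \<tau>) {p. P p}
      = measure (distr (\<tau> \<Otimes>\<^sub>M \<sigma>) (\<sigma> \<Otimes>\<^sub>M \<tau>) (\<lambda>(x, y). (y, x))) {p. P p}"
    by (subst distr_pair_swap) simp
  also have "\<dots> = measure (\<tau> \<Otimes>\<^sub>M \<sigma>) {p. P (snd p, fst p)}"
    by (subst measure_distr) (auto simp: A B space_pair_measure measurable_pair_swap'
        intro!: arg_cong[where f="measure _"])
  finally show ?thesis .
qed

lemma tail_convolution:
  assumes "real_distribution \<sigma>" "real_distribution \<tau>"
  shows "tail (\<sigma> \<star> \<tau>) x = measure (\<sigma> \<Otimes>\<^sub>M \<tau>) {p. x < fst p + snd p}"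
proof -
  interpret S: real_distribution \<sigma> by fact
  interpret T: real_distribution \<tau> by fact
  show ?thesis
    unfolding tail_def convolution_def
    by (subst measure_distr) (auto simp: space_pair_measure intro!: arg_cong[where f="measure _"])
qed

lemma tail_convolution_integral:
  assumes "real_distribution \<sigma>" "real_distribution \<tau>"
  shows "tail (\<sigma> \<star> \<tau>) x = (\<integral>s. tail \<tau> (x - s) \<partial>\<sigma>)"
  using measure_pair_tail[OF assms, of UNIV "\<lambda>s. x - s"]
  by (simp add: tail_convolution assms algebra_simps)

lemma joint_commute:
  assumes "real_distribution \<sigma>" "real_distribution \<tau>"
  shows "joint \<sigma> \<tau> A x = joint \<tau> \<sigma> A x"
  unfolding joint_def
  by (subst measure_pair_swap[OF assms]) (auto simp: conj_ac add_ac)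

text \<open>Once s > A is fixed, both conditions on the second coordinate say that it exceeds
  \<open>max A (x - s)\<close>. So \<open>tail \<tau>\<close> enters exactly once, and a pointwise
  bound on it can be inserted.\<close>

lemma joint_integral:
  assumes "real_distribution \<sigma>" "real_distribution \<tau>"
  shows "joint \<sigma> \<tau> A x = (\<integral>s. indicator {A<..} s * tail \<tau> (max A (x - s)) \<partial>\<sigma>)"
proof -
  have "{p::real \<times> real. A < fst p \<and> A < snd p \<and> x < fst p + snd p}
      = {p. fst p \<in> {A<..} \<and> max A (x - fst p) < snd p}"
    by auto
  then show ?thesis
    unfolding joint_def using measure_pair_tail[OF assms, of "{A<..}" "\<lambda>s. max A (x - s)"] by simp
qed

lemma joint_le_dominated:
  assumes "real_distribution \<sigma>" "real_distribution \<tau>" "real_distribution \<rho>"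
    and "\<And>x. tail \<tau> x \<le> K * tail \<rho> x"
  shows "joint \<sigma> \<tau> A x \<le> K * joint \<sigma> \<rho> A x"
proof -
  have "joint \<sigma> \<tau> A x \<le> (\<integral>s. K * (indicator {A<..} s * tail \<rho> (max A (x - s))) \<partial>\<sigma>)"
    unfolding joint_integral[OF assms(1,2)]
    by (intro integral_mono integrable_mult_right integrable_tail assms)
       (auto split: split_indicator simp: assms(4))
  then show ?thesis
    by (simp add: joint_integral assms)
qed

text \<open>\<open>joint_le_dominated\<close> replaces only the second factor by \<rho>;
  \<open>joint_commute\<close> brings the other factor into that position.\<close>

lemma joint_le_dominated2:
  assumes "real_distribution \<sigma>" "real_distribution \<tau>" "real_distribution \<rho>"
    and "\<And>x. tail \<sigma> x \<le> K * tail \<rho> x" "\<And>x. tail \<tau> x \<le> L * tail \<rho> x" "0 \<le> L"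
  shows "joint \<sigma> \<tau> A x \<le> L * K * joint \<rho> \<rho> A x"
proof -
  have "joint \<sigma> \<tau> A x \<le> L * joint \<rho> \<sigma> A x"
    using joint_le_dominated[OF assms(1,2,3,5)] by (simp add: joint_commute assms)
  also have "\<dots> \<le> L * (K * joint \<rho> \<rho> A x)"
    by (intro mult_left_mono joint_le_dominated assms)
  finally show ?thesis by (simp add: mult.assoc)
qed

text \<open>For \<open>x \<ge> 2 * A\<close> the summands cannot both be at most \<open>A\<close>, so the events behind the first two terms are disjoint.\<close>

lemma tail_convolution_split:
  assumes "real_distribution \<sigma>" "real_distribution \<tau>" "2 * A \<le> x"
  shows "tail (\<sigma> \<star> \<tau>) x = conv_below \<sigma> \<tau> A x + conv_below \<tau> \<sigma> A x + joint \<sigma> \<tau> A x"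
proof -
  interpret S: real_distribution \<sigma> by fact
  interpret T: real_distribution \<tau> by fact
  interpret pair_prob_space \<sigma> \<tau> ..
  let ?P = "\<sigma> \<Otimes>\<^sub>M \<tau>"
  let ?A = "{p::real \<times> real. fst p \<le> A \<and> x < fst p + snd p}"
  let ?B = "{p::real \<times> real. snd p \<le> A \<and> x < fst p + snd p}"
  let ?C = "{p::real \<times> real. A < fst p \<and> A < snd p \<and> x < fst p + snd p}"
  have A: "{p \<in> space ?P. fst p \<le> A \<and> x < fst p + snd p} \<in> sets ?P"
    and B: "{p \<in> space ?P. snd p \<le> A \<and> x < fst p + snd p} \<in> sets ?P"
    and C: "{p \<in> space ?P. A < fst p \<and> A < snd p \<and> x < fst p + snd p} \<in> sets ?P"
    by measurable
  have disj: "?A \<inter> ?B = {}" "(?A \<union> ?B) \<inter> ?C = {}" and un: "?A \<union> ?B \<union> ?C = {p. x < fst p + snd p}"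
    using assms(3) by auto
  have "measure ?P {p. x < fst p + snd p} = measure ?P (?A \<union> ?B) + measure ?P ?C"
    unfolding un[symmetric] using A B C disj
    by (intro P.finite_measure_Union) (auto simp: space_pair_measure)
  also have "measure ?P (?A \<union> ?B) = measure ?P ?A + measure ?P ?B"
    using A B disj by (intro P.finite_measure_Union) (auto simp: space_pair_measure)
  also have "measure ?P ?A = conv_below \<sigma> \<tau> A x"
    using measure_pair_tail[OF assms(1,2), of "{..A}" "\<lambda>s. x - s"]
    by (simp add: conv_below_def algebra_simps)
  also have "measure ?P ?B = conv_below \<tau> \<sigma> A x"
    using measure_pair_tail[OF assms(2,1), of "{..A}" "\<lambda>s. x - s"]
    by (subst measure_pair_swap[OF assms(1,2)]) (simp_all add: conv_below_def algebra_simps)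
  finally show ?thesis
    by (simp add: tail_convolution assms joint_def)
qed

section \<open>Asymptotic one-sided bounds for sequences\<close>

text \<open>This is liminf f \<ge> c, and \<open>asymp_le\<close> is limsup f \<le> c, phrased
  without extended real values.\<close>

definition asymp_ge :: "(nat \<Rightarrow> real) \<Rightarrow> real \<Rightarrow> bool" where
  "asymp_ge f c \<longleftrightarrow> (\<forall>d<c. \<forall>\<^sub>F j in sequentially. d < f j)"

definition asymp_le :: "(nat \<Rightarrow> real) \<Rightarrow> real \<Rightarrow> bool" where
  "asymp_le f c \<longleftrightarrow> (\<forall>d>c. \<forall>\<^sub>F j in sequentially. f j < d)"

lemma asymp_le_minus: "asymp_le (\<lambda>j. - f j) (- c) \<longleftrightarrow> asymp_ge f c"
proof
  assume le: "asymp_le (\<lambda>j. - f j) (- c)"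
  show "asymp_ge f c"
    unfolding asymp_ge_def
  proof (intro allI impI)
    fix d assume "d < c"
    then show "\<forall>\<^sub>F j in sequentially. d < f j"
      using le[unfolded asymp_le_def, rule_format, of "- d"] by simp
  qed
next
  assume ge: "asymp_ge f c"
  show "asymp_le (\<lambda>j. - f j) (- c)"
    unfolding asymp_le_def
  proof (intro allI impI)
    fix d assume "- c < d"
    then have "- d < c" by simp
    then have "\<forall>\<^sub>F j in sequentially. - d < f j"
      using ge by (simp add: asymp_ge_def)
    then show "\<forall>\<^sub>F j in sequentially. - f j < d"
      by eventually_elim simp
  qed
qed

lemma tendsto_iff_asymp: "f \<longlonglongrightarrow> c \<longleftrightarrow> asymp_ge f c \<and> asymp_le f c"
  unfolding asymp_le_def asymp_ge_def order_tendsto_iff by auto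

lemma asymp_le_mono:
  assumes "asymp_le f c" "\<forall>\<^sub>F j in sequentially. g j \<le> f j" "c \<le> d"
  shows "asymp_le g d"
  unfolding asymp_le_def
proof (intro allI impI)
  fix e assume "d < e"
  with assms(1,3) have "\<forall>\<^sub>F j in sequentially. f j < e"
    by (auto simp: asymp_le_def)
  with assms(2) show "\<forall>\<^sub>F j in sequentially. g j < e"
    by eventually_elim auto
qed

lemma asymp_ge_mono:
  assumes "asymp_ge f c" "\<forall>\<^sub>F j in sequentially. f j \<le> g j" "d \<le> c"
  shows "asymp_ge g d"
  using asymp_le_mono[of "\<lambda>j. - f j" "- c" "\<lambda>j. - g j" "- d"] assms by (simp add: asymp_le_minus)

lemma asymp_le_add:
  assumes "asymp_le f c" "asymp_le g d"
  shows "asymp_le (\<lambda>j. f j + g j) (c + d)"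
  unfolding asymp_le_def
proof (intro allI impI)
  fix e assume e: "c + d < e"
  have "\<forall>\<^sub>F j in sequentially. f j < c + (e - (c + d)) / 2"
    "\<forall>\<^sub>F j in sequentially. g j < d + (e - (c + d)) / 2"
    using assms e by (auto simp: asymp_le_def)
  then show "\<forall>\<^sub>F j in sequentially. f j + g j < e"
    by eventually_elim (simp add: field_simps)
qed

lemma asymp_ge_add: "asymp_ge f c \<Longrightarrow> asymp_ge g d \<Longrightarrow> asymp_ge (\<lambda>j. f j + g j) (c + d)"
  using asymp_le_add[of "\<lambda>j. - f j" "- c" "\<lambda>j. - g j" "- d"] asymp_le_minus[of "\<lambda>j. f j + g j" "c + d"]
  by (simp add: asymp_le_minus)

lemma asymp_le_cmult:
  assumes "asymp_le f c" "0 \<le> a"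
  shows "asymp_le (\<lambda>j. a * f j) (a * c)"
proof (cases "a = 0")
  case False
  show ?thesis
    unfolding asymp_le_def
  proof (intro allI impI)
    fix e assume "a * c < e"
    then have "c < e / a"
      using False assms(2) by (simp add: field_simps)
    then have "\<forall>\<^sub>F j in sequentially. f j < e / a"
      using assms by (auto simp: asymp_le_def)
    then show "\<forall>\<^sub>F j in sequentially. a * f j < e"
      by eventually_elim (use False assms(2) in \<open>simp add: field_simps\<close>)
  qed
qed (simp add: asymp_le_def)

text \<open>A one-sided bound becomes genuine convergence after truncation at the bound, which makes
  dominated convergence and \<open>tendsto_le\<close> applicable.\<close>

lemma asymp_ge_iff_min: "asymp_ge f c \<longleftrightarrow> (\<lambda>j. min (f j) c) \<longlonglongrightarrow> c"
  unfolding order_tendsto_iff asymp_ge_def by (auto simp: min_less_iff_disj)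

lemma asymp_le_iff_max: "asymp_le f c \<longleftrightarrow> (\<lambda>j. max (f j) c) \<longlonglongrightarrow> c"
  unfolding order_tendsto_iff asymp_le_def by (auto simp: less_max_iff_disj)

lemma asymp_le_imp_le: "asymp_le f c \<Longrightarrow> f \<longlonglongrightarrow> l \<Longrightarrow> l \<le> c"
  unfolding asymp_le_iff_max by (rule tendsto_le[OF sequentially_bot]) auto

lemma asymp_ge_imp_ge: "asymp_ge f c \<Longrightarrow> f \<longlonglongrightarrow> l \<Longrightarrow> c \<le> l"
  unfolding asymp_ge_iff_min by (rule tendsto_le[OF sequentially_bot]) auto

text \<open>A form of Fatou's lemma. Since f is nonnegative, min (f j x) (p x) lies between -|p x|
  and |p x|, so dominated convergence applies to the truncated functions.\<close>

lemma asymp_ge_integral: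
  fixes f :: "nat \<Rightarrow> 'a \<Rightarrow> real"
  assumes f: "\<And>j. integrable M (f j)" and p: "integrable M p"
    and nonneg: "\<And>j x. 0 \<le> f j x" and ge: "\<And>x. asymp_ge (\<lambda>j. f j x) (p x)"
  shows "asymp_ge (\<lambda>j. \<integral>x. f j x \<partial>M) (\<integral>x. p x \<partial>M)"
proof -
  have "(\<lambda>j. \<integral>x. min (f j x) (p x) \<partial>M) \<longlonglongrightarrow> (\<integral>x. p x \<partial>M)"
  proof (rule integral_dominated_convergence[where w="\<lambda>x. \<bar>p x\<bar>"])
    show "AE x in M. norm (min (f j x) (p x)) \<le> \<bar>p x\<bar>" for j
    proof (rule AE_I2)
      fix x show "norm (min (f j x) (p x)) \<le> \<bar>p x\<bar>"
        using nonneg[of j x] unfolding real_norm_def by linarith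
    qed
    show "AE x in M. (\<lambda>j. min (f j x) (p x)) \<longlonglongrightarrow> p x"
      using ge by (simp add: asymp_ge_iff_min)
  qed (use f p in auto)
  then show ?thesis
    unfolding tendsto_iff_asymp
    by (elim conjE asymp_ge_mono) (auto intro!: always_eventually integral_mono integrable_min f p)
qed

text \<open>Reverse Fatou. Truncating from below at p does not control large values, so the majorant
  w has to do that.\<close>

lemma asymp_le_integral:
  fixes f :: "nat \<Rightarrow> 'a \<Rightarrow> real"
  assumes f: "\<And>j. integrable M (f j)" and p: "integrable M p" and w: "integrable M w"
    and nonneg: "\<And>j x. 0 \<le> f j x" and dom: "\<And>j x. f j x \<le> w x"
    and le: "\<And>x. asymp_le (\<lambda>j. f j x) (p x)"
  shows "asymp_le (\<lambda>j. \<integral>x. f j x \<partial>M) (\<integral>x. p x \<partial>M)"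
proof -
  have "(\<lambda>j. \<integral>x. max (f j x) (p x) \<partial>M) \<longlonglongrightarrow> (\<integral>x. p x \<partial>M)"
  proof (rule integral_dominated_convergence[where w="\<lambda>x. \<bar>p x\<bar> + w x"])
    show "AE x in M. norm (max (f j x) (p x)) \<le> \<bar>p x\<bar> + w x" for j
    proof (rule AE_I2)
      fix x show "norm (max (f j x) (p x)) \<le> \<bar>p x\<bar> + w x"
        using nonneg[of j x] dom[of j x] unfolding real_norm_def by linarith
    qed
    show "AE x in M. (\<lambda>j. max (f j x) (p x)) \<longlonglongrightarrow> p x"
      using le by (simp add: asymp_le_iff_max)
  qed (use f p w in auto)
  then show ?thesis
    unfolding tendsto_iff_asymp
    by (elim conjE asymp_le_mono) (auto intro!: always_eventually integral_mono integrable_max f p)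
qed

text \<open>Serves to remove auxiliary parameters, namely truncation levels and error factors, after
  the passage to the limit in j.\<close>

lemma asymp_ge_limit:
  assumes "\<And>m. asymp_ge f (g m)" "g \<longlonglongrightarrow> c"
  shows "asymp_ge f c"
  unfolding asymp_ge_def
proof (intro allI impI)
  fix d assume "d < c"
  then obtain m where "d < g m"
    using eventually_happens'[OF sequentially_bot order_tendstoD(1)[OF assms(2)]] by blast
  then show "\<forall>\<^sub>F j in sequentially. d < f j"
    using assms(1) by (auto simp: asymp_ge_def)
qed

lemma asymp_le_limit:
  assumes "\<And>m. asymp_le f (g m)" "g \<longlonglongrightarrow> c"
  shows "asymp_le f c"
  unfolding asymp_le_def
proof (intro allI impI)
  fix d assume "c < d"
  then obtain m where "g m < d"
    using eventually_happens'[OF sequentially_bot order_tendstoD(2)[OF assms(2)]] by blast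
  then show "\<forall>\<^sub>F j in sequentially. f j < d"
    using assms(1) by (auto simp: asymp_le_def)
qed


section \<open>Exponential moments\<close>

text \<open>The cut-off at -A keeps the shift u - s within distance A of u for the values s that
  count. Lower bounds known only on a half-line of shifts can then be integrated.\<close>

definition tmgf :: "real \<Rightarrow> real measure \<Rightarrow> real \<Rightarrow> real" where
  "tmgf \<gamma> \<sigma> A = (\<integral>s. indicator {-A..A} s * exp (\<gamma> * s) \<partial>\<sigma>)"

definition rmgf :: "real \<Rightarrow> real measure \<Rightarrow> real" where
  "rmgf \<gamma> \<sigma> = (\<integral>s. exp (\<gamma> * s) \<partial>\<sigma>)"

lemma integrable_indicator_exp:
  assumes "real_distribution \<sigma>" "integrable \<sigma> (\<lambda>s. exp (\<gamma> * s))" "S \<in> sets borel"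
  shows "integrable \<sigma> (\<lambda>s. indicator S s * exp (\<gamma> * s :: real))"
proof -
  interpret real_distribution \<sigma> by fact
  show ?thesis
    using integrable_real_mult_indicator[OF _ assms(2), of S] assms(3) by (simp add: mult.commute)
qed

lemma tmgf_tendsto:
  assumes "real_distribution \<sigma>" "integrable \<sigma> (\<lambda>s. exp (\<gamma> * s))"
  shows "(\<lambda>m. tmgf \<gamma> \<sigma> (real m)) \<longlonglongrightarrow> rmgf \<gamma> \<sigma>"
proof -
  interpret real_distribution \<sigma> by fact
  show ?thesis
    unfolding tmgf_def rmgf_def
  proof (rule integral_dominated_convergence[where w="\<lambda>s. exp (\<gamma> * s)"])
    show "AE s in \<sigma>. (\<lambda>m. indicator {- real m..real m} s * exp (\<gamma> * s)) \<longlonglongrightarrow> exp (\<gamma> * s)"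
    proof (rule AE_I2, rule tendsto_eventually)
      fix s :: real
      obtain N where N: "\<bar>s\<bar> \<le> real N"
        using real_arch_simple by blast
      show "\<forall>\<^sub>F m in sequentially. indicator {- real m..real m} s * exp (\<gamma> * s) = exp (\<gamma> * s)"
        using eventually_ge_at_top[of N]
      proof eventually_elim
        case (elim m)
        then have "real N \<le> real m" by simp
        with N have "\<bar>s\<bar> \<le> real m" by linarith
        then have "s \<in> {- real m..real m}" by auto
        then show ?case by simp
      qed
    qed
    show "AE s in \<sigma>. norm (indicator {- real m..real m} s * exp (\<gamma> * s)) \<le> exp (\<gamma> * s)" for m
      by (intro AE_I2) (auto split: split_indicator)
  qed (use assms in auto)
qed

lemma rmgf_pos:
  assumes "real_distribution \<sigma>" "integrable \<sigma> (\<lambda>s. exp (\<gamma> * s))"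
  shows "0 < rmgf \<gamma> \<sigma>"
  using mgf_pos[OF assms(1), of \<gamma>] unfolding mgf_eq_integral[OF assms(2)] rmgf_def
  by simp

text \<open>Both claims are read off the extended real identity \<open>mgf_convolution\<close>: a
  product of finite moments is finite, and nonnegativity allows \<open>ennreal\<close> to be
  cancelled.\<close>

lemma rmgf_convolution:
  assumes "real_distribution \<sigma>" "integrable \<sigma> (\<lambda>s. exp (\<gamma> * s))"
    and "real_distribution \<tau>" "integrable \<tau> (\<lambda>s. exp (\<gamma> * s))"
  shows "integrable (\<sigma> \<star> \<tau>) (\<lambda>s. exp (\<gamma> * s))" "rmgf \<gamma> (\<sigma> \<star> \<tau>) = rmgf \<gamma> \<sigma> * rmgf \<gamma> \<tau>"
proof -
  show i: "integrable (\<sigma> \<star> \<tau>) (\<lambda>s. exp (\<gamma> * s))"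
    using assms by (simp add: integrable_exp_iff real_distribution_convolution mgf_convolution
      ennreal_mult_less_top)
  have "ennreal (rmgf \<gamma> (\<sigma> \<star> \<tau>)) = ennreal (rmgf \<gamma> \<sigma>) * ennreal (rmgf \<gamma> \<tau>)"
    using mgf_convolution[OF assms(1,3), of \<gamma>]
    unfolding mgf_eq_integral[OF i] mgf_eq_integral[OF assms(2)] mgf_eq_integral[OF assms(4)] rmgf_def .
  then show "rmgf \<gamma> (\<sigma> \<star> \<tau>) = rmgf \<gamma> \<sigma> * rmgf \<gamma> \<tau>"
    using assms by (simp add: ennreal_mult[symmetric] rmgf_pos less_imp_le i real_distribution_convolution)
qed

lemma rmgf_conv_pow:
  assumes "real_distribution \<sigma>" "integrable \<sigma> (\<lambda>s. exp (\<gamma> * s))"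
  shows "integrable (conv_pow \<sigma> k) (\<lambda>s. exp (\<gamma> * s))" "rmgf \<gamma> (conv_pow \<sigma> k) = rmgf \<gamma> \<sigma> ^ k"
proof (induction k)
  case 0
  case 1
  show ?case
    by (simp add: integrable_exp_iff[OF real_distribution_conv_pow[OF assms(1), of 0, simplified]]
        mgf_def nn_integral_return)
  case 2
  show ?case by (simp add: rmgf_def integral_return)
next
  case (Suc k)
  case 1
  show ?case
    using rmgf_convolution(1)[OF assms real_distribution_conv_pow[OF assms(1)] Suc.IH(1)] by simp
  case 2
  show ?case
    using rmgf_convolution(2)[OF assms real_distribution_conv_pow[OF assms(1)] Suc.IH(1)] Suc.IH(2)
    by simp
qed

section \<open>Measures dominated by a convolution equivalent distribution\<close>

text \<open>Let X and Y be independent with laws \<sigma> and \<tau>. Some b satisfies P(Y > b) > 0,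
  and X > x together with Y > b forces X + Y > x + b. Hence p = \<open>tail \<tau> b\<close> and B =
  -b.\<close>

lemma tail_factor_bound:
  assumes "real_distribution \<sigma>" "real_distribution \<tau>"
  obtains B p where "0 < p" "\<And>x. p * tail \<sigma> x \<le> tail (\<sigma> \<star> \<tau>) (x - B)"
proof -
  interpret T: real_distribution \<tau> by fact
  have "\<forall>\<^sub>F x in at_bot. cdf \<tau> x < 1"
    by (rule order_tendstoD(2)[OF T.cdf_lim_at_bot]) simp
  then obtain b where "cdf \<tau> b < 1"
    by (auto simp: eventually_at_bot_linorder)
  moreover have "tail \<tau> b = 1 - cdf \<tau> b"
    using T.prob_compl[of "{..b}"] by (simp add: tail_def cdf_def Compl_eq_Diff_UNIV[symmetric])
  ultimately have b: "0 < tail \<tau> b" by simp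
  have "tail \<tau> b * tail \<sigma> x \<le> tail (\<sigma> \<star> \<tau>) (x - (- b))" for x
  proof -
    have "tail \<tau> b * tail \<sigma> x = (\<integral>s. indicator {b<..} s * tail \<sigma> x \<partial>\<tau>)"
      by (simp add: tail_def)
    also have "\<dots> \<le> (\<integral>s. indicator UNIV s * tail \<sigma> (x + b - s) \<partial>\<tau>)"
      by (intro integral_mono integrable_tail assms)
        (auto split: split_indicator simp: tail_nonneg intro!: tail_antimono assms)
    also have "\<dots> = tail (\<sigma> \<star> \<tau>) (x - (- b))"
      by (simp add: convolution_comm[OF assms] tail_convolution_integral[OF assms(2,1)])
    finally show ?thesis .
  qed
  with b show thesis by (rule that)
qed

text \<open>Under the shift y \<ge> 0 the part \<open>f1\<close> gains at most a factor 1 + d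
  eventually, and \<open>f2\<close> does not grow. Passing from g to the combination h and back
  costs (1 + d) / (1 - d).\<close>

lemma fun_M_almost_decreasing:
  assumes "fun_M g" "0 \<le> y" "0 < e"
  shows "\<forall>\<^sub>F x in at_top. g (x + y) \<le> (1 + e) * g x"
proof -
  obtain a f1 f2 where a: "0 \<le> a" "a \<le> 1" and f1: "fun_L f1"
    and f2: "\<And>x. f2 x > 0" "antimono f2"
    and g: "asymp_eq_top g (\<lambda>x. a * f1 x + (1 - a) * f2 x)"
    using assms(1) by (auto simp: fun_M_def)
  have g_nonneg: "0 \<le> g x" for x
    using assms(1) by (simp add: fun_M_def)
  have f1_nonneg: "0 \<le> f1 x" for x
    using f1 by (simp add: fun_L_def)
  define h where "h x = a * f1 x + (1 - a) * f2 x" for x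
  have h_nonneg: "0 \<le> h x" for x
    using a f2(1)[of x] f1_nonneg[of x] by (simp add: h_def)
  have lim: "((\<lambda>x. g x / h x) \<longlongrightarrow> 1) at_top"
    using g by (simp add: asymp_eq_top_def h_def)
  \<comment> \<open>The accumulated factor tends to 1 as d tends to 0, so some d in (0,1) keeps it
    below 1 + e.\<close>
  have "((\<lambda>d::real. (1 + d) * (1 + d) / (1 - d)) \<longlongrightarrow> (1 + 0) * (1 + 0) / (1 - 0)) (at_right 0)"
    by (intro tendsto_intros) auto
  then have "\<forall>\<^sub>F d in at_right 0. (1 + d) * (1 + d) / (1 - d) < 1 + e"
    by (rule order_tendstoD) (use assms(3) in simp)
  moreover have "\<forall>\<^sub>F d in at_right 0. 0 < d \<and> d < (1::real)"
    by (auto simp: eventually_at_right[of 0 1] intro!: exI[of _ 1])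
  ultimately have "\<forall>\<^sub>F d in at_right 0. (1 + d) * (1 + d) / (1 - d) < 1 + e \<and> 0 < d \<and> d < (1::real)"
    by eventually_elim auto
  then obtain d where d: "(1 + d) * (1 + d) / (1 - d) < 1 + e" "0 < d" "d < (1::real)"
    using eventually_happens trivial_limit_at_right_real by (metis (mono_tags, lifting))
  have "\<forall>\<^sub>F x in at_top. 1 - d < g x / h x" "\<forall>\<^sub>F x in at_top. g x / h x < 1 + d"
    using d by (auto intro: order_tendstoD[OF lim])
  then have bounds: "\<forall>\<^sub>F x in at_top. g x \<le> (1 + d) * h x \<and> (1 - d) * h x \<le> g x"
  proof eventually_elim
    case (elim x)
    \<comment> \<open>If h x were 0, the quotient would be 0 by convention and could not exceed 1 -
      d.\<close>
    then have "h x \<noteq> 0" using d by auto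
    then have "0 < h x" using h_nonneg[of x] by simp
    with elim show ?case
      by (simp add: field_simps)
  qed
  have y: "filterlim (\<lambda>x. x + y) at_top at_top"
    using filterlim_tendsto_add_at_top[OF tendsto_const filterlim_ident, of y] by (simp add: add.commute)
  have "\<forall>\<^sub>F x in at_top. g x \<le> (1 + d) * h x"
    using bounds by eventually_elim simp
  then have shifted: "\<forall>\<^sub>F x in at_top. g (x + y) \<le> (1 + d) * h (x + y)"
    using y by (rule eventually_compose_filterlim)
  have "((\<lambda>x. f1 (x + y) / f1 x) \<longlongrightarrow> 1) at_top" "\<forall>\<^sub>F x in at_top. f1 x > 0"
    using f1 by (auto simp: fun_L_def asymp_eq_top_def)
  then have "\<forall>\<^sub>F x in at_top. f1 (x + y) / f1 x < 1 + d" "\<forall>\<^sub>F x in at_top. f1 x > 0"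
    using d by (auto intro: order_tendstoD)
  with shifted bounds show ?thesis
  proof eventually_elim
    case (elim x)
    have f2': "f2 (x + y) \<le> (1 + d) * f2 x"
    proof -
      have "f2 (x + y) \<le> f2 x"
        using f2(2) assms(2) by (auto simp: antimono_def)
      also have "\<dots> \<le> (1 + d) * f2 x"
        using d(2) f2(1)[of x] by (simp add: distrib_right)
      finally show ?thesis .
    qed
    have "a * f1 (x + y) + (1 - a) * f2 (x + y) \<le> a * ((1 + d) * f1 x) + (1 - a) * ((1 + d) * f2 x)"
      using elim a f2' by (intro add_mono mult_left_mono) (auto simp: field_simps)
    then have "h (x + y) \<le> (1 + d) * h x"
      by (simp add: h_def algebra_simps)
    then have "(1 + d) * h (x + y) \<le> (1 + d) * ((1 + d) * h x)"
      using d by (intro mult_left_mono) auto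
    with elim have "g (x + y) \<le> (1 + d) * ((1 + d) * h x)" by linarith
    also have "\<dots> \<le> (1 + d) * ((1 + d) * (g x / (1 - d)))"
      using elim d by (intro mult_left_mono) (auto simp: field_simps)
    also have "\<dots> = (1 + d) * (1 + d) / (1 - d) * g x" by simp
    also have "\<dots> \<le> (1 + e) * g x"
      using d g_nonneg by (intro mult_right_mono) auto
    finally show ?case .
  qed
qed

section \<open>Domination by a fixed convolution equivalent distribution \<rho>\<close>

locale convolution_equivalent = real_distribution \<rho> for \<rho> +
  fixes \<gamma> :: real
  assumes class_S: "class_S \<gamma> \<rho>"
begin

lemma rho: "real_distribution \<rho>"
  by (rule real_distribution_axioms)

lemma tail_pos: "0 < tail \<rho> x"
  using class_S by (simp add: class_S_def class_L_def)

lemma exp_integrable: "integrable \<rho> (\<lambda>s. exp (\<gamma> * s))"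
  using class_S by (simp add: integrable_exp_iff[OF rho] class_S_def)

lemma tail_ratio: "((\<lambda>x. tail \<rho> (x + a) / tail \<rho> x) \<longlongrightarrow> exp (- \<gamma> * a)) at_top"
proof -
  have "((\<lambda>x. exp (- \<gamma> * a) * (tail \<rho> (x + a) / (exp (- \<gamma> * a) * tail \<rho> x)))
      \<longlongrightarrow> exp (- \<gamma> * a) * 1) at_top"
    using class_S unfolding class_S_def class_L_def asymp_eq_top_def
    by (intro tendsto_mult_left) auto
  then show ?thesis by simp
qed

lemma tail_convolution_ratio:
  "((\<lambda>x. tail (\<rho> \<star> \<rho>) x / tail \<rho> x) \<longlongrightarrow> 2 * rmgf \<gamma> \<rho>) at_top"
proof -
  have M: "enn2real (mgf \<rho> \<gamma>) = rmgf \<gamma> \<rho>" "0 < rmgf \<gamma> \<rho>"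
    using rmgf_pos[OF rho exp_integrable]
    by (simp_all add: mgf_eq_integral[OF exp_integrable] rmgf_def)
  have "((\<lambda>x. 2 * rmgf \<gamma> \<rho> * (tail (\<rho> \<star> \<rho>) x / (2 * rmgf \<gamma> \<rho> * tail \<rho> x)))
      \<longlongrightarrow> 2 * rmgf \<gamma> \<rho> * 1) at_top"
    using class_S unfolding class_S_def asymp_eq_top_def conv_pow_2[OF rho] M
    by (intro tendsto_mult_left) auto
  then show ?thesis using M by simp
qed

text \<open>The bound is required at every x and not just eventually, because it is used under
  integrals over all shifts.\<close>

definition dominated :: "real measure \<Rightarrow> bool" where
  "dominated \<sigma> \<longleftrightarrow> real_distribution \<sigma> \<and> integrable \<sigma> (\<lambda>s. exp (\<gamma> * s)) \<and>
    (\<exists>K\<ge>0. \<forall>x. tail \<sigma> x \<le> K * tail \<rho> x)"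

lemma dominatedE:
  assumes "dominated \<sigma>"
  obtains K where "0 \<le> K" "\<And>x. tail \<sigma> x \<le> K * tail \<rho> x"
  using assms by (auto simp: dominated_def)

text \<open>Beyond some x0 the limit bounds the quotient. To the left of x0 the tail of \<rho> is at
  least its positive value at x0, while f is at most 1.\<close>

lemma bounded_by_tail:
  assumes "\<And>x. f x \<le> 1" "((\<lambda>x. f x / tail \<rho> x) \<longlongrightarrow> l) at_top"
  shows "\<exists>K\<ge>0. \<forall>x. f x \<le> K * tail \<rho> x"
proof -
  have "\<forall>\<^sub>F x in at_top. f x / tail \<rho> x < l + 1"
    using order_tendstoD(2)[OF assms(2), of "l + 1"] by simp
  then obtain x0 where x0: "\<And>x. x0 \<le> x \<Longrightarrow> f x / tail \<rho> x < l + 1"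
    by (auto simp: eventually_at_top_linorder)
  define K where "K = max (l + 1) (1 / tail \<rho> x0)"
  have "f x \<le> K * tail \<rho> x" for x
  proof (cases "x0 \<le> x")
    case True
    then have "f x \<le> (l + 1) * tail \<rho> x"
      using x0[OF True] tail_pos[of x] by (simp add: field_simps)
    also have "\<dots> \<le> K * tail \<rho> x"
      by (intro mult_right_mono) (simp_all add: K_def tail_nonneg)
    finally show ?thesis .
  next
    case False
    then have "1 \<le> 1 / tail \<rho> x0 * tail \<rho> x"
      using tail_antimono[OF rho, of x x0] tail_pos[of x0] by simp
    with assms(1)[of x] have "f x \<le> 1 / tail \<rho> x0 * tail \<rho> x"
      by (rule order_trans)
    also have "\<dots> \<le> K * tail \<rho> x"
      by (intro mult_right_mono) (simp_all add: K_def tail_nonneg)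
    finally show ?thesis .
  qed
  moreover have "0 \<le> K"
    using tail_pos[of x0] by (simp add: K_def le_max_iff_disj)
  ultimately show ?thesis by blast
qed

text \<open>The factors are replaced by \<rho> one after the other, using commutativity; convolution
  equivalence then bounds the tail of \<open>\<rho> \<star> \<rho>\<close> by a multiple of the tail
  of \<rho>.\<close>

lemma dominated_convolution:
  assumes "dominated \<sigma>" "dominated \<tau>"
  shows "dominated (\<sigma> \<star> \<tau>)"
proof -
  have S: "real_distribution \<sigma>" "integrable \<sigma> (\<lambda>s. exp (\<gamma> * s))"
    and T: "real_distribution \<tau>" "integrable \<tau> (\<lambda>s. exp (\<gamma> * s))"
    using assms by (auto simp: dominated_def)
  have aux: "tail (\<sigma>' \<star> \<tau>') x \<le> K * tail (\<sigma>' \<star> \<rho>) x"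
    if "real_distribution \<sigma>'" "real_distribution \<tau>'" "\<And>x. tail \<tau>' x \<le> K * tail \<rho> x" for \<sigma>' \<tau>' K x
  proof -
    have i: "integrable \<sigma>' (\<lambda>s. tail \<upsilon> (x - s))" if "real_distribution \<upsilon>" for \<upsilon>
      using integrable_tail[OF \<open>real_distribution \<sigma>'\<close> that, of UNIV "\<lambda>s. x - s"] by simp
    have "(\<integral>s. tail \<tau>' (x - s) \<partial>\<sigma>') \<le> (\<integral>s. K * tail \<rho> (x - s) \<partial>\<sigma>')"
      by (intro integral_mono integrable_mult_right i that rho)
    then show ?thesis
      by (simp add: tail_convolution_integral that rho)
  qed
  obtain K where K: "0 \<le> K" "\<And>x. tail \<sigma> x \<le> K * tail \<rho> x"
    using dominatedE[OF assms(1)] by blast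
  obtain L where L: "0 \<le> L" "\<And>x. tail \<tau> x \<le> L * tail \<rho> x"
    using dominatedE[OF assms(2)] by blast
  obtain N where N: "0 \<le> N" "\<And>x. tail (\<rho> \<star> \<rho>) x \<le> N * tail \<rho> x"
    using bounded_by_tail[OF _ tail_convolution_ratio]
      tail_le_1[OF real_distribution_convolution[OF rho rho]] by auto
  have "tail (\<sigma> \<star> \<tau>) x \<le> L * K * N * tail \<rho> x" for x
  proof -
    have "tail (\<sigma> \<star> \<tau>) x \<le> L * tail (\<rho> \<star> \<sigma>) x"
      using aux[OF S(1) T(1) L(2)] by (simp add: convolution_comm[OF S(1) rho])
    also have "\<dots> \<le> L * (K * tail (\<rho> \<star> \<rho>) x)"
      by (intro mult_left_mono aux rho S K L)
    also have "\<dots> \<le> L * (K * (N * tail \<rho> x))"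
      by (intro mult_left_mono N K L)
    finally show ?thesis by (simp add: mult.assoc)
  qed
  moreover have "0 \<le> L * K * N"
    using K L N by simp
  ultimately show ?thesis
    using rmgf_convolution(1)[OF S T] real_distribution_convolution[OF S(1) T(1)]
    by (auto simp: dominated_def)
qed

text \<open>The bounds are normalised at \<open>t j\<close> instead of \<open>t j + u\<close>, so that a convolution acts on them
  by integrating the exponential factor alone.\<close>

definition lower :: "(nat \<Rightarrow> real) \<Rightarrow> real measure \<Rightarrow> real \<Rightarrow> real set \<Rightarrow> bool" where
  "lower t \<sigma> C U \<longleftrightarrow> (\<forall>u\<in>U. asymp_ge (\<lambda>j. tail \<sigma> (t j + u) / tail \<rho> (t j)) (C * exp (- \<gamma> * u)))"

definition upper :: "(nat \<Rightarrow> real) \<Rightarrow> real measure \<Rightarrow> real \<Rightarrow> real set \<Rightarrow> bool" where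
  "upper t \<sigma> C U \<longleftrightarrow> (\<forall>u\<in>U. asymp_le (\<lambda>j. tail \<sigma> (t j + u) / tail \<rho> (t j)) (C * exp (- \<gamma> * u)))"

lemma lower_mono:
  assumes "lower t \<sigma> C U" "D \<le> C"
  shows "lower t \<sigma> D U"
  unfolding lower_def
proof
  fix u assume "u \<in> U"
  with assms(1) have "asymp_ge (\<lambda>j. tail \<sigma> (t j + u) / tail \<rho> (t j)) (C * exp (- \<gamma> * u))"
    by (simp add: lower_def)
  then show "asymp_ge (\<lambda>j. tail \<sigma> (t j + u) / tail \<rho> (t j)) (D * exp (- \<gamma> * u))"
    by (rule asymp_ge_mono) (simp_all add: assms(2))
qed

lemma upper_mono:
  assumes "upper t \<sigma> C U" "C \<le> D"
  shows "upper t \<sigma> D U"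
  unfolding upper_def
proof
  fix u assume "u \<in> U"
  with assms(1) have "asymp_le (\<lambda>j. tail \<sigma> (t j + u) / tail \<rho> (t j)) (C * exp (- \<gamma> * u))"
    by (simp add: upper_def)
  then show "asymp_le (\<lambda>j. tail \<sigma> (t j + u) / tail \<rho> (t j)) (D * exp (- \<gamma> * u))"
    by (rule asymp_le_mono) (simp_all add: assms(2))
qed

section \<open>One convolution acting on asymptotic bounds along a sequence\<close>

context
  fixes t :: "nat \<Rightarrow> real"
  assumes t: "filterlim t at_top sequentially"
begin

lemma shift_at_top: "filterlim (\<lambda>j. t j + u) at_top sequentially"
  using filterlim_tendsto_add_at_top[OF tendsto_const t, of u] by (simp add: add.commute)

lemma tail_ratio_seq: "(\<lambda>j. tail \<rho> (t j + u) / tail \<rho> (t j)) \<longlonglongrightarrow> exp (- \<gamma> * u)"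
  using filterlim_compose[OF tail_ratio t] .

text \<open>The factor exp (- \<gamma> * (u - s)) splits into exp (- \<gamma> * u) and exp (\<gamma>
  * s), so integrating the pointwise bounds over s produces the truncated moment.\<close>

lemma conv_below_lower:
  assumes \<sigma>: "real_distribution \<sigma>" "integrable \<sigma> (\<lambda>s. exp (\<gamma> * s))" and \<tau>: "real_distribution \<tau>"
    and low: "lower t \<tau> C U" and U: "\<And>s. s \<in> {-A..A} \<Longrightarrow> u - s \<in> U"
  shows "asymp_ge (\<lambda>j. conv_below \<sigma> \<tau> A (t j + u) / tail \<rho> (t j)) (C * tmgf \<gamma> \<sigma> A * exp (- \<gamma> * u))"
proof -
  have "asymp_ge (\<lambda>j. \<integral>s. indicator {..A} s * tail \<tau> (t j + u - s) / tail \<rho> (t j) \<partial>\<sigma>)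
      (\<integral>s. C * exp (- \<gamma> * u) * (indicator {-A..A} s * exp (\<gamma> * s)) \<partial>\<sigma>)"
  proof (rule asymp_ge_integral)
    show "integrable \<sigma> (\<lambda>s. indicator {..A} s * tail \<tau> (t j + u - s) / tail \<rho> (t j))" for j
      by (intro integrable_divide integrable_tail \<sigma> \<tau>) auto
    show "integrable \<sigma> (\<lambda>s. C * exp (- \<gamma> * u) * (indicator {-A..A} s * exp (\<gamma> * s)))"
      by (intro integrable_mult_right integrable_indicator_exp \<sigma>) auto
    show "0 \<le> indicator {..A} s * tail \<tau> (t j + u - s) / tail \<rho> (t j)" for j s
      by (simp add: tail_nonneg)
    fix s
    show "asymp_ge (\<lambda>j. indicator {..A} s * tail \<tau> (t j + u - s) / tail \<rho> (t j))
        (C * exp (- \<gamma> * u) * (indicator {-A..A} s * exp (\<gamma> * s)))"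
    proof (cases "s \<in> {-A..A}")
      case True
      have "asymp_ge (\<lambda>j. tail \<tau> (t j + (u - s)) / tail \<rho> (t j)) (C * exp (- \<gamma> * (u - s)))"
        using low U[OF True] by (auto simp: lower_def)
      moreover have "exp (- \<gamma> * (u - s)) = exp (- \<gamma> * u) * exp (\<gamma> * s)"
        by (simp add: exp_add[symmetric] algebra_simps)
      ultimately show ?thesis
        using True by (simp add: add_diff_eq mult.assoc)
    next
      \<comment> \<open>The target is 0 here and the integrand is nonnegative.\<close>
      case False
      then show ?thesis
        by (auto simp: asymp_ge_def tail_nonneg intro!: always_eventually less_le_trans[of _ 0])
    qed
  qed
  moreover have "(\<integral>s. C * exp (- \<gamma> * u) * (indicator {-A..A} s * exp (\<gamma> * s)) \<partial>\<sigma>)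
      = C * tmgf \<gamma> \<sigma> A * exp (- \<gamma> * u)"
    by (simp add: tmgf_def)
  ultimately show ?thesis
    by (simp only: conv_below_def integral_divide_zero)
qed

text \<open>For s \<le> A, domination and monotonicity compare the integrand with the tail of \<rho>
  at t j + (u - A). Its ratio to the tail at t j converges and is therefore bounded, which gives the
  constant majorant K * b for reverse Fatou.\<close>

lemma conv_below_upper:
  assumes \<sigma>: "real_distribution \<sigma>" "integrable \<sigma> (\<lambda>s. exp (\<gamma> * s))" and \<tau>: "dominated \<tau>"
    and up: "upper t \<tau> C U" "0 \<le> C" and U: "\<And>s. s \<le> A \<Longrightarrow> u - s \<in> U"
  shows "asymp_le (\<lambda>j. conv_below \<sigma> \<tau> A (t j + u) / tail \<rho> (t j)) (C * rmgf \<gamma> \<sigma> * exp (- \<gamma> * u))"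
proof -
  interpret S: real_distribution \<sigma> by fact
  have \<tau>': "real_distribution \<tau>"
    using \<tau> by (simp add: dominated_def)
  obtain K where K: "0 \<le> K" "\<And>x. tail \<tau> x \<le> K * tail \<rho> x"
    using dominatedE[OF \<tau>] by blast
  have "Bseq (\<lambda>j. tail \<rho> (t j + (u - A)) / tail \<rho> (t j))"
    using tail_ratio_seq[of "u - A"] by (intro convergent_imp_Bseq convergentI)
  then obtain b where b: "0 < b" "\<And>j. norm (tail \<rho> (t j + (u - A)) / tail \<rho> (t j)) \<le> b"
    by (auto simp: Bseq_def)
  have "asymp_le (\<lambda>j. \<integral>s. indicator {..A} s * tail \<tau> (t j + u - s) / tail \<rho> (t j) \<partial>\<sigma>)
      (\<integral>s. C * exp (- \<gamma> * u) * (indicator {..A} s * exp (\<gamma> * s)) \<partial>\<sigma>)"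
  proof (rule asymp_le_integral)
    show "integrable \<sigma> (\<lambda>s. indicator {..A} s * tail \<tau> (t j + u - s) / tail \<rho> (t j))" for j
      by (intro integrable_divide integrable_tail \<sigma> \<tau>') auto
    show "integrable \<sigma> (\<lambda>s. C * exp (- \<gamma> * u) * (indicator {..A} s * exp (\<gamma> * s)))"
      by (intro integrable_mult_right integrable_indicator_exp \<sigma>) auto
    show "integrable \<sigma> (\<lambda>s. K * b)"
      by simp
    show "0 \<le> indicator {..A} s * tail \<tau> (t j + u - s) / tail \<rho> (t j)" for j s
      by (simp add: tail_nonneg)
    show "indicator {..A} s * tail \<tau> (t j + u - s) / tail \<rho> (t j) \<le> K * b" for j s
    proof (cases "s \<le> A")
      case True
      have "tail \<tau> (t j + u - s) \<le> K * tail \<rho> (t j + u - s)"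
        by (rule K)
      also have "\<dots> \<le> K * tail \<rho> (t j + (u - A))"
        using True by (intro mult_left_mono K tail_antimono rho) simp
      finally have "tail \<tau> (t j + u - s) / tail \<rho> (t j) \<le> K * (tail \<rho> (t j + (u - A)) / tail \<rho> (t j))"
        using tail_pos[of "t j"] by (simp add: divide_right_mono)
      also have "\<dots> \<le> K * b"
        using b(2)[of j] by (intro mult_left_mono K) (simp add: tail_nonneg)
      finally show ?thesis using True by simp
    qed (use K b in auto)
    fix s
    show "asymp_le (\<lambda>j. indicator {..A} s * tail \<tau> (t j + u - s) / tail \<rho> (t j))
        (C * exp (- \<gamma> * u) * (indicator {..A} s * exp (\<gamma> * s)))"
    proof (cases "s \<le> A")
      case True
      have "asymp_le (\<lambda>j. tail \<tau> (t j + (u - s)) / tail \<rho> (t j)) (C * exp (- \<gamma> * (u - s)))"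
        using up U[OF True] by (auto simp: upper_def)
      moreover have "exp (- \<gamma> * (u - s)) = exp (- \<gamma> * u) * exp (\<gamma> * s)"
        by (simp add: exp_add[symmetric] algebra_simps)
      ultimately show ?thesis
        using True by (simp add: add_diff_eq mult.assoc)
    qed (simp add: asymp_le_def)
  qed
  \<comment> \<open>Extending the integral from {..A} to the whole line only increases it, because C
    \<ge> 0.\<close>
  moreover have "(\<integral>s. C * exp (- \<gamma> * u) * (indicator {..A} s * exp (\<gamma> * s)) \<partial>\<sigma>)
      \<le> C * rmgf \<gamma> \<sigma> * exp (- \<gamma> * u)"
  proof -
    have "(\<integral>s. C * exp (- \<gamma> * u) * (indicator {..A} s * exp (\<gamma> * s)) \<partial>\<sigma>)
        \<le> (\<integral>s. C * exp (- \<gamma> * u) * exp (\<gamma> * s) \<partial>\<sigma>)"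
      by (intro integral_mono integrable_mult_right integrable_indicator_exp \<sigma> mult_left_mono)
        (auto split: split_indicator simp: up)
    also have "(\<integral>s. C * exp (- \<gamma> * u) * exp (\<gamma> * s) \<partial>\<sigma>) = C * rmgf \<gamma> \<sigma> * exp (- \<gamma> * u)"
      by (simp add: rmgf_def)
    finally show ?thesis .
  qed
  ultimately show ?thesis
    by (elim asymp_le_mono) (simp_all add: conv_below_def)
qed

lemma lower_rho: "lower t \<rho> 1 UNIV"
  using tail_ratio_seq by (auto simp: lower_def tendsto_iff_asymp)

lemma eventually_ge: "\<forall>\<^sub>F j in sequentially. x \<le> t j + u"
  using shift_at_top[of u] by (simp add: filterlim_at_top)

text \<open>The right-hand side vanishes as \<open>A\<close> grows: two large summands are negligible.\<close>

lemma joint_upper: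
  "asymp_le (\<lambda>j. joint \<rho> \<rho> A (t j + u) / tail \<rho> (t j))
    (2 * (rmgf \<gamma> \<rho> - tmgf \<gamma> \<rho> A) * exp (- \<gamma> * u))"
proof -
  let ?B = "\<lambda>j. conv_below \<rho> \<rho> A (t j + u) / tail \<rho> (t j)"
  \<comment> \<open>The splitting writes the joint part as the full tail minus two copies of
    \<open>conv_below\<close>. The full tail has a known limit, so a lower bound for these copies is
    an upper bound for the joint part.\<close>
  have "asymp_ge ?B (1 * tmgf \<gamma> \<rho> A * exp (- \<gamma> * u))"
    by (rule conv_below_lower[OF rho exp_integrable rho lower_rho]) simp
  then have "asymp_ge (\<lambda>j. ?B j + ?B j) (tmgf \<gamma> \<rho> A * exp (- \<gamma> * u) + tmgf \<gamma> \<rho> A * exp (- \<gamma> * u))"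
    by (intro asymp_ge_add) simp_all
  then have 1: "asymp_le (\<lambda>j. - (?B j + ?B j)) (- (tmgf \<gamma> \<rho> A * exp (- \<gamma> * u) + tmgf \<gamma> \<rho> A * exp (- \<gamma> * u)))"
    by (simp only: asymp_le_minus)
  have "(\<lambda>j. tail (\<rho> \<star> \<rho>) (t j + u) / tail \<rho> (t j + u) * (tail \<rho> (t j + u) / tail \<rho> (t j)))
      \<longlonglongrightarrow> 2 * rmgf \<gamma> \<rho> * exp (- \<gamma> * u)"
    by (intro tendsto_mult tail_ratio_seq filterlim_compose[OF tail_convolution_ratio shift_at_top])
  then have 2: "asymp_le (\<lambda>j. tail (\<rho> \<star> \<rho>) (t j + u) / tail \<rho> (t j)) (2 * rmgf \<gamma> \<rho> * exp (- \<gamma> * u))"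
    using tail_pos by (simp add: less_imp_neq[THEN not_sym] tendsto_iff_asymp)
  show ?thesis
  proof (rule asymp_le_mono[OF asymp_le_add[OF 1 2]])
    show "\<forall>\<^sub>F j in sequentially. joint \<rho> \<rho> A (t j + u) / tail \<rho> (t j)
        \<le> - (?B j + ?B j) + tail (\<rho> \<star> \<rho>) (t j + u) / tail \<rho> (t j)"
      using eventually_ge[of "2 * A" u]
      by eventually_elim (simp add: tail_convolution_split[OF rho rho] add_divide_distrib)
  qed (simp add: algebra_simps)
qed

text \<open>With \<open>U = {..-B}\<close> the admissible \<open>V\<close> is \<open>{..-B - A}\<close>; with \<open>U = UNIV\<close> nothing is lost.\<close>

lemma lower_convolution:
  assumes \<sigma>: "real_distribution \<sigma>" "integrable \<sigma> (\<lambda>s. exp (\<gamma> * s))"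
    and \<tau>: "real_distribution \<tau>" "integrable \<tau> (\<lambda>s. exp (\<gamma> * s))"
    and low: "lower t \<sigma> C U" "lower t \<tau> D U" and U: "\<And>u s. u \<in> V \<Longrightarrow> s \<in> {-A..A} \<Longrightarrow> u - s \<in> U"
  shows "lower t (\<sigma> \<star> \<tau>) (C * tmgf \<gamma> \<tau> A + D * tmgf \<gamma> \<sigma> A) V"
  unfolding lower_def
proof
  fix u assume u: "u \<in> V"
  show "asymp_ge (\<lambda>j. tail (\<sigma> \<star> \<tau>) (t j + u) / tail \<rho> (t j))
      ((C * tmgf \<gamma> \<tau> A + D * tmgf \<gamma> \<sigma> A) * exp (- \<gamma> * u))"
  proof (rule asymp_ge_mono[OF asymp_ge_add])
    show "asymp_ge (\<lambda>j. conv_below \<sigma> \<tau> A (t j + u) / tail \<rho> (t j)) (D * tmgf \<gamma> \<sigma> A * exp (- \<gamma> * u))"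
      by (rule conv_below_lower) (use assms u in auto)
    show "asymp_ge (\<lambda>j. conv_below \<tau> \<sigma> A (t j + u) / tail \<rho> (t j)) (C * tmgf \<gamma> \<tau> A * exp (- \<gamma> * u))"
      by (rule conv_below_lower) (use assms u in auto)
    show "\<forall>\<^sub>F j in sequentially. conv_below \<sigma> \<tau> A (t j + u) / tail \<rho> (t j)
        + conv_below \<tau> \<sigma> A (t j + u) / tail \<rho> (t j) \<le> tail (\<sigma> \<star> \<tau>) (t j + u) / tail \<rho> (t j)"
      using eventually_ge[of "2 * A" u]
      by eventually_elim
        (simp add: tail_convolution_split[OF \<sigma>(1) \<tau>(1)] add_divide_distrib joint_def tail_nonneg)
  qed (simp add: algebra_simps)
qed

text \<open>The last term of the constant stems from two large summands: domination moves that event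
  to \<rho> at the cost of L * K. For \<open>U = {B..}\<close> one may take
  \<open>V = {B + A..}\<close>, since only s \<le> A is subtracted.\<close>

lemma upper_convolution:
  assumes \<sigma>: "dominated \<sigma>" and \<tau>: "dominated \<tau>"
    and K: "\<And>x. tail \<sigma> x \<le> K * tail \<rho> x" "0 \<le> K"
    and L: "\<And>x. tail \<tau> x \<le> L * tail \<rho> x" "0 \<le> L"
    and up: "upper t \<sigma> C U" "upper t \<tau> D U" "0 \<le> C" "0 \<le> D"
    and U: "\<And>u s. u \<in> V \<Longrightarrow> s \<le> A \<Longrightarrow> u - s \<in> U"
  shows "upper t (\<sigma> \<star> \<tau>) (C * rmgf \<gamma> \<tau> + D * rmgf \<gamma> \<sigma> + L * K * (2 * (rmgf \<gamma> \<rho> - tmgf \<gamma> \<rho> A))) V"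
  unfolding upper_def
proof
  fix u assume u: "u \<in> V"
  have \<sigma>': "real_distribution \<sigma>" "integrable \<sigma> (\<lambda>s. exp (\<gamma> * s))"
    and \<tau>': "real_distribution \<tau>" "integrable \<tau> (\<lambda>s. exp (\<gamma> * s))"
    using \<sigma> \<tau> by (auto simp: dominated_def)
  show "asymp_le (\<lambda>j. tail (\<sigma> \<star> \<tau>) (t j + u) / tail \<rho> (t j))
      ((C * rmgf \<gamma> \<tau> + D * rmgf \<gamma> \<sigma> + L * K * (2 * (rmgf \<gamma> \<rho> - tmgf \<gamma> \<rho> A))) * exp (- \<gamma> * u))"
  proof (rule asymp_le_mono[OF asymp_le_add[OF asymp_le_add]])
    show "asymp_le (\<lambda>j. conv_below \<sigma> \<tau> A (t j + u) / tail \<rho> (t j)) (D * rmgf \<gamma> \<sigma> * exp (- \<gamma> * u))"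
      by (rule conv_below_upper[OF \<sigma>' \<tau> up(2,4)]) (use U u in auto)
    show "asymp_le (\<lambda>j. conv_below \<tau> \<sigma> A (t j + u) / tail \<rho> (t j)) (C * rmgf \<gamma> \<tau> * exp (- \<gamma> * u))"
      by (rule conv_below_upper[OF \<tau>' \<sigma> up(1,3)]) (use U u in auto)
    show "asymp_le (\<lambda>j. L * K * (joint \<rho> \<rho> A (t j + u) / tail \<rho> (t j)))
        (L * K * (2 * (rmgf \<gamma> \<rho> - tmgf \<gamma> \<rho> A) * exp (- \<gamma> * u)))"
      by (intro asymp_le_cmult joint_upper) (simp add: K L)
    show "\<forall>\<^sub>F j in sequentially. tail (\<sigma> \<star> \<tau>) (t j + u) / tail \<rho> (t j)
        \<le> conv_below \<sigma> \<tau> A (t j + u) / tail \<rho> (t j) + conv_below \<tau> \<sigma> A (t j + u) / tail \<rho> (t j)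
          + L * K * (joint \<rho> \<rho> A (t j + u) / tail \<rho> (t j))"
      using eventually_ge[of "2 * A" u]
    proof eventually_elim
      case (elim j)
      have "joint \<sigma> \<tau> A (t j + u) \<le> L * K * joint \<rho> \<rho> A (t j + u)"
        using joint_le_dominated2[OF \<sigma>'(1) \<tau>'(1) rho K(1) L] .
      then have "joint \<sigma> \<tau> A (t j + u) / tail \<rho> (t j) \<le> L * K * joint \<rho> \<rho> A (t j + u) / tail \<rho> (t j)"
        by (intro divide_right_mono tail_nonneg)
      then show ?case
        using elim by (simp add: tail_convolution_split[OF \<sigma>'(1) \<tau>'(1)] add_divide_distrib)
    qed
  qed (simp add: algebra_simps)
qed

end

section \<open>Convolution powers and the limit of the tail ratio\<close>

lemma dominated_conv_pow:
  assumes "dominated \<sigma>"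
  shows "dominated (conv_pow \<sigma> k)"
proof (induction k)
  case 0
  have \<sigma>: "real_distribution \<sigma>" "integrable \<sigma> (\<lambda>s. exp (\<gamma> * s))"
    using assms by (auto simp: dominated_def)
  have R: "real_distribution (return borel 0)"
    using real_distribution_conv_pow[OF \<sigma>(1), of 0] by simp
  have "\<forall>\<^sub>F x in at_top. tail (return borel 0) x / tail \<rho> x = 0"
    using eventually_ge_at_top[of "0::real"]
    by eventually_elim (simp add: tail_def measure_return)
  then have "((\<lambda>x. tail (return borel 0) x / tail \<rho> x) \<longlongrightarrow> 0) at_top"
    by (rule tendsto_eventually)
  from bounded_by_tail[OF tail_le_1[OF R] this]
  show ?case
    using rmgf_conv_pow(1)[OF \<sigma>, of 0] R by (simp add: dominated_def)
qed (simp add: dominated_convolution assms)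

text \<open>By \<open>tail_factor_bound\<close> the tail of the factor is controlled by a shifted
  tail of \<rho>. The exponential tail ratio of \<rho> absorbs the fixed shift into a
  constant.\<close>

lemma dominated_factor:
  assumes "real_distribution \<sigma>" "integrable \<sigma> (\<lambda>s. exp (\<gamma> * s))" "real_distribution \<tau>"
    and "\<rho> = (\<sigma> \<star> \<tau>)"
  shows "dominated \<sigma>"
proof -
  obtain B p where p: "0 < p" "\<And>x. p * tail \<sigma> x \<le> tail \<rho> (x - B)"
    using tail_factor_bound[OF assms(1,3)] unfolding assms(4) by blast
  obtain K where K: "0 \<le> K" "\<And>x. tail \<rho> (x + - B) \<le> K * tail \<rho> x"
    using bounded_by_tail[OF tail_le_1[OF rho] tail_ratio, of "- B"] by blast
  have "tail \<sigma> x \<le> K / p * tail \<rho> x" for x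
    using order_trans[OF p(2)[of x] K(2)[of x, simplified]] p(1)
    by (simp add: field_simps)
  with K(1) p(1) show ?thesis
    unfolding dominated_def by (intro conjI assms exI[of _ "K / p"]) auto
qed

section \<open>Bounds for convolution powers and the value of subsequential limits\<close>

context
  fixes t :: "nat \<Rightarrow> real"
  assumes t: "filterlim t at_top sequentially"
begin

text \<open>Any one of the k summands may be the large one, and the other k - 1 contribute a factor
  \<open>rmgf \<gamma> \<mu>\<close> each. The strict inequality leaves room for truncating moments
  at every induction step; in exchange B grows.\<close>

lemma lower_conv_pow:
  assumes \<mu>: "dominated \<mu>" and low: "lower t \<mu> w {..0}"
  shows "C < w * (real k * rmgf \<gamma> \<mu> ^ (k - 1)) \<Longrightarrow> \<exists>B\<ge>0. lower t (conv_pow \<mu> k) C {..-B}"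
proof (induction k arbitrary: C)
  case 0
  \<comment> \<open>For k = 0 the constant is 0, so C < 0 and nonnegativity of tails
    suffices.\<close>
  have "asymp_ge (\<lambda>j. tail (return borel 0) (t j + u) / tail \<rho> (t j)) (C * exp (- \<gamma> * u))" for u
    unfolding asymp_ge_def
  proof (intro allI impI always_eventually)
    fix d j assume "d < C * exp (- \<gamma> * u)"
    also have "\<dots> < 0"
      using 0 by (simp add: mult_neg_pos)
    also have "0 \<le> tail (return borel 0) (t j + u) / tail \<rho> (t j)"
      by (simp add: tail_nonneg)
    finally show "d < tail (return borel 0) (t j + u) / tail \<rho> (t j)" .
  qed
  then show ?case
    by (intro exI[of _ 0]) (simp add: lower_def)
next
  case (Suc k)
  have \<mu>': "real_distribution \<mu>" "integrable \<mu> (\<lambda>s. exp (\<gamma> * s))"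
    using \<mu> by (auto simp: dominated_def)
  let ?M = "rmgf \<gamma> \<mu>" and ?\<tau> = "conv_pow \<mu> k"
  let ?C = "w * (real k * ?M ^ (k - 1))"
  \<comment> \<open>The constant given by \<open>lower_convolution\<close> at truncation level m,
    with the induction hypothesis used at a loss of 1 / (m + 1).\<close>
  let ?g = "\<lambda>m. w * tmgf \<gamma> ?\<tau> (real m) + (?C - inverse (real (Suc m))) * tmgf \<gamma> \<mu> (real m)"
  have "?g \<longlonglongrightarrow> w * rmgf \<gamma> ?\<tau> + (?C - 0) * ?M"
    by (intro tendsto_intros tmgf_tendsto \<mu>' real_distribution_conv_pow rmgf_conv_pow
        LIMSEQ_inverse_real_of_nat)
  also have "w * rmgf \<gamma> ?\<tau> + (?C - 0) * ?M = w * (real (Suc k) * ?M ^ (Suc k - 1))"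
    \<comment> \<open>The case split resolves the natural subtraction \<open>k - 1\<close>; for
      positive k this is M^k + k * M^(k-1) * M = (k+1) * M^k, times w.\<close>
    unfolding rmgf_conv_pow(2)[OF \<mu>'] by (cases k) (simp_all add: algebra_simps)
  finally have lim: "?g \<longlonglongrightarrow> w * (real (Suc k) * ?M ^ (Suc k - 1))" .
  obtain m where m: "C < ?g m"
    using eventually_happens'[OF sequentially_bot order_tendstoD(1)[OF lim Suc.prems]] by blast
  obtain B where B: "0 \<le> B" "lower t ?\<tau> (?C - inverse (real (Suc m))) {..-B}"
    using Suc.IH[of "?C - inverse (real (Suc m))"] by auto
  have "lower t (\<mu> \<star> ?\<tau>) (?g m) {..-(B + real m)}"
  proof (rule lower_convolution[OF t \<mu>' _ _ _ B(2)])
    show "lower t \<mu> w {..-B}"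
      using low B(1) by (auto simp: lower_def)
  qed (auto simp: \<mu>' real_distribution_conv_pow rmgf_conv_pow)
  then have "lower t (conv_pow \<mu> (Suc k)) C {..-(B + real m)}"
    unfolding conv_pow.simps by (rule lower_mono) (rule less_imp_le[OF m])
  then show ?case
    using B(1) by (intro exI[of _ "B + real m"]) auto
qed

text \<open>The same count of summands, now with bounds to the right. The error from two large
  summands also enters; it is controlled because every power of \<mu> is dominated by
  \<rho>.\<close>

lemma upper_conv_pow:
  assumes \<mu>: "dominated \<mu>" and up: "upper t \<mu> w {0..}" and w: "0 \<le> w"
  shows "w * (real k * rmgf \<gamma> \<mu> ^ (k - 1)) < C \<Longrightarrow> \<exists>B\<ge>0. upper t (conv_pow \<mu> k) C {B..}"
proof (induction k arbitrary: C)
  case 0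
  have "asymp_le (\<lambda>j. tail (return borel 0) (t j + u) / tail \<rho> (t j)) (C * exp (- \<gamma> * u))" for u
  proof -
    have "\<forall>\<^sub>F j in sequentially. tail (return borel 0) (t j + u) / tail \<rho> (t j) = 0"
      using eventually_ge[OF t, of 0 u] by eventually_elim (simp add: tail_def measure_return)
    then have "(\<lambda>j. tail (return borel 0) (t j + u) / tail \<rho> (t j)) \<longlonglongrightarrow> 0"
      by (rule tendsto_eventually)
    then show ?thesis
      unfolding tendsto_iff_asymp using 0 by (elim conjE asymp_le_mono) auto
  qed
  then show ?case
    by (intro exI[of _ 0]) (simp add: upper_def)
next
  case (Suc k)
  have \<mu>': "real_distribution \<mu>" "integrable \<mu> (\<lambda>s. exp (\<gamma> * s))"
    using \<mu> by (auto simp: dominated_def)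
  let ?M = "rmgf \<gamma> \<mu>" and ?\<tau> = "conv_pow \<mu> k"
  let ?C = "w * (real k * ?M ^ (k - 1))"
  have C: "0 \<le> ?C"
    using w rmgf_pos[OF \<mu>'] by simp
  have \<tau>: "dominated ?\<tau>"
    by (rule dominated_conv_pow[OF \<mu>])
  obtain K where K: "0 \<le> K" "\<And>x. tail \<mu> x \<le> K * tail \<rho> x"
    using dominatedE[OF \<mu>] by blast
  obtain L where L: "0 \<le> L" "\<And>x. tail ?\<tau> x \<le> L * tail \<rho> x"
    using dominatedE[OF \<tau>] by blast
  \<comment> \<open>The level m serves both as truncation point, making the last term vanish in the
    limit, and as the source of the loss 1 / (m + 1).\<close>
  let ?g = "\<lambda>m. w * rmgf \<gamma> ?\<tau> + (?C + inverse (real (Suc m))) * ?M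
      + L * K * (2 * (rmgf \<gamma> \<rho> - tmgf \<gamma> \<rho> (real m)))"
  have "?g \<longlonglongrightarrow> w * rmgf \<gamma> ?\<tau> + (?C + 0) * ?M + L * K * (2 * (rmgf \<gamma> \<rho> - rmgf \<gamma> \<rho>))"
    by (intro tendsto_intros tmgf_tendsto rho exp_integrable LIMSEQ_inverse_real_of_nat)
  also have "w * rmgf \<gamma> ?\<tau> + (?C + 0) * ?M + L * K * (2 * (rmgf \<gamma> \<rho> - rmgf \<gamma> \<rho>))
      = w * (real (Suc k) * ?M ^ (Suc k - 1))"
    unfolding rmgf_conv_pow(2)[OF \<mu>'] by (cases k) (simp_all add: algebra_simps)
  finally have lim: "?g \<longlonglongrightarrow> w * (real (Suc k) * ?M ^ (Suc k - 1))" .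
  obtain m where m: "?g m < C"
    using eventually_happens'[OF sequentially_bot order_tendstoD(2)[OF lim Suc.prems]] by blast
  obtain B where B: "0 \<le> B" "upper t ?\<tau> (?C + inverse (real (Suc m))) {B..}"
    using Suc.IH[of "?C + inverse (real (Suc m))"] by auto
  have "upper t (\<mu> \<star> ?\<tau>) (?g m) {B + real m..}"
  proof (rule upper_convolution[OF t \<mu> \<tau> K(2,1) L(2,1) _ B(2) w])
    show "upper t \<mu> w {B..}"
      using up B(1) by (auto simp: upper_def)
    show "0 \<le> ?C + inverse (real (Suc m))"
      using C by (intro add_nonneg_nonneg) auto
  qed auto
  then have "upper t (conv_pow \<mu> (Suc k)) C {B + real m..}"
    unfolding conv_pow.simps by (rule upper_mono) (rule less_imp_le[OF m])
  then show ?case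
    using B(1) by (intro exI[of _ "B + real m"]) auto
qed

lemma lower_rho_le_1:
  assumes "lower t \<rho> C {u}"
  shows "C \<le> 1"
proof -
  have "C * exp (- \<gamma> * u) \<le> exp (- \<gamma> * u)"
    using assms by (intro asymp_ge_imp_ge[OF _ tail_ratio_seq[OF t]]) (simp add: lower_def)
  then show ?thesis by simp
qed

lemma upper_rho_ge_1:
  assumes "upper t \<rho> C {u}"
  shows "1 \<le> C"
proof -
  have "exp (- \<gamma> * u) \<le> C * exp (- \<gamma> * u)"
    using assms by (intro asymp_le_imp_le[OF _ tail_ratio_seq[OF t]]) (simp add: upper_def)
  then show ?thesis by simp
qed

text \<open>By \<open>dec\<close>, the limit w at shift 0 is a lower constant for all shifts u \<le>
  0 and an upper constant for all u \<ge> 0. Both are carried to the n-th power, which is \<rho>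
  itself and has exact constant 1.\<close>

lemma ratio_limit_unique:
  assumes \<mu>: "dominated \<mu>" and \<rho>: "\<rho> = conv_pow \<mu> n"
    and dec: "\<And>y e. 0 \<le> y \<Longrightarrow> 0 < e \<Longrightarrow>
      \<forall>\<^sub>F x in at_top. tail \<mu> (x + y) \<le> (1 + e) * (exp (- \<gamma> * y) * tail \<mu> x)"
    and w: "(\<lambda>j. tail \<mu> (t j) / tail \<rho> (t j)) \<longlonglongrightarrow> w"
  shows "w * (real n * rmgf \<gamma> \<mu> ^ (n - 1)) = 1"
proof (rule antisym)
  have w0: "0 \<le> w"
    by (rule LIMSEQ_le_const[OF w]) (auto simp: tail_nonneg)
  have inv: "(\<lambda>m. 1 + inverse (real (Suc m))) \<longlonglongrightarrow> 1 + 0"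
    by (intro tendsto_intros LIMSEQ_inverse_real_of_nat)
  have pos: "0 < inverse (real (Suc m))" for m by simp
  have "lower t \<mu> w {..0}"
    unfolding lower_def
  proof
    fix u :: real assume u: "u \<in> {..0}"
    show "asymp_ge (\<lambda>j. tail \<mu> (t j + u) / tail \<rho> (t j)) (w * exp (- \<gamma> * u))"
    proof (rule asymp_ge_limit)
      show "(\<lambda>m. w * exp (- \<gamma> * u) / (1 + inverse (real (Suc m)))) \<longlonglongrightarrow> w * exp (- \<gamma> * u)"
        using tendsto_divide[OF tendsto_const inv, of "w * exp (- \<gamma> * u)"] by simp
      fix m
      let ?e = "inverse (real (Suc m))"
      have "(\<lambda>j. tail \<mu> (t j) / tail \<rho> (t j) * exp (- \<gamma> * u) / (1 + ?e)) \<longlonglongrightarrow> w * exp (- \<gamma> * u) / (1 + ?e)"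
        using pos[of m] by (intro tendsto_intros w) linarith
      then have "asymp_ge (\<lambda>j. tail \<mu> (t j) / tail \<rho> (t j) * exp (- \<gamma> * u) / (1 + ?e)) (w * exp (- \<gamma> * u) / (1 + ?e))"
        by (simp add: tendsto_iff_asymp)
      then show "asymp_ge (\<lambda>j. tail \<mu> (t j + u) / tail \<rho> (t j)) (w * exp (- \<gamma> * u) / (1 + ?e))"
      proof (rule asymp_ge_mono)
        \<comment> \<open>\<open>dec\<close> is applied at t j + u with the shift -u \<ge> 0, which
          leads back to t j and so bounds the tail at the left point from below.\<close>
        have "\<forall>\<^sub>F x in at_top. tail \<mu> (x + - u) \<le> (1 + ?e) * (exp (- \<gamma> * - u) * tail \<mu> x)"
          using u by (intro dec) auto
        then have "\<forall>\<^sub>F j in sequentially. tail \<mu> (t j + u + - u) \<le> (1 + ?e) * (exp (- \<gamma> * - u) * tail \<mu> (t j + u))"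
          using shift_at_top[OF t, of u] by (auto simp: filterlim_iff)
        then show "\<forall>\<^sub>F j in sequentially. tail \<mu> (t j) / tail \<rho> (t j) * exp (- \<gamma> * u) / (1 + ?e)
            \<le> tail \<mu> (t j + u) / tail \<rho> (t j)"
        proof eventually_elim
          case (elim j)
          have "tail \<mu> (t j) * exp (- \<gamma> * u) \<le> (1 + ?e) * (exp (\<gamma> * u) * tail \<mu> (t j + u)) * exp (- \<gamma> * u)"
            using elim by (intro mult_right_mono) auto
          also have "\<dots> = (1 + ?e) * tail \<mu> (t j + u)"
            by (simp add: exp_minus)
          finally have le: "tail \<mu> (t j) * exp (- \<gamma> * u) / (1 + ?e) \<le> tail \<mu> (t j + u)"
            by (subst pos_divide_le_eq) (use pos[of m] in \<open>simp_all only: mult.commute add_pos_pos zero_less_one\<close>)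
          then show ?case
            using divide_right_mono[OF le tail_nonneg, of \<rho> "t j"] by (simp add: mult.commute)
        qed
      qed simp
    qed
  qed
  note low = lower_conv_pow[OF \<mu> this, of _ n, folded \<rho>]
  \<comment> \<open>Every C strictly below the value is a lower constant for \<rho> on some
    half-line of shifts. One shift from it already gives C \<le> 1, and density does the
    rest.\<close>
  show "w * (real n * rmgf \<gamma> \<mu> ^ (n - 1)) \<le> 1"
  proof (rule dense_le)
    fix C assume "C < w * (real n * rmgf \<gamma> \<mu> ^ (n - 1))"
    from low[OF this] show "C \<le> 1"
      using lower_rho_le_1 by (fastforce simp: lower_def)
  qed
  have "upper t \<mu> w {0..}"
    unfolding upper_def
  proof
    fix u :: real assume u: "u \<in> {0..}"
    show "asymp_le (\<lambda>j. tail \<mu> (t j + u) / tail \<rho> (t j)) (w * exp (- \<gamma> * u))"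
    proof (rule asymp_le_limit)
      show "(\<lambda>m. (1 + inverse (real (Suc m))) * (w * exp (- \<gamma> * u))) \<longlonglongrightarrow> w * exp (- \<gamma> * u)"
        using tendsto_mult[OF inv tendsto_const, of "w * exp (- \<gamma> * u)"] by simp
      fix m
      let ?e = "inverse (real (Suc m))"
      have "(\<lambda>j. (1 + ?e) * (tail \<mu> (t j) / tail \<rho> (t j) * exp (- \<gamma> * u))) \<longlonglongrightarrow> (1 + ?e) * (w * exp (- \<gamma> * u))"
        by (intro tendsto_intros w)
      then have "asymp_le (\<lambda>j. (1 + ?e) * (tail \<mu> (t j) / tail \<rho> (t j) * exp (- \<gamma> * u))) ((1 + ?e) * (w * exp (- \<gamma> * u)))"
        by (simp add: tendsto_iff_asymp)
      then show "asymp_le (\<lambda>j. tail \<mu> (t j + u) / tail \<rho> (t j)) ((1 + ?e) * (w * exp (- \<gamma> * u)))"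
      proof (rule asymp_le_mono)
        have "\<forall>\<^sub>F x in at_top. tail \<mu> (x + u) \<le> (1 + ?e) * (exp (- \<gamma> * u) * tail \<mu> x)"
          using u by (intro dec) auto
        then have "\<forall>\<^sub>F j in sequentially. tail \<mu> (t j + u) \<le> (1 + ?e) * (exp (- \<gamma> * u) * tail \<mu> (t j))"
          using t by (auto simp: filterlim_iff)
        then show "\<forall>\<^sub>F j in sequentially. tail \<mu> (t j + u) / tail \<rho> (t j)
            \<le> (1 + ?e) * (tail \<mu> (t j) / tail \<rho> (t j) * exp (- \<gamma> * u))"
        proof eventually_elim
          case (elim j)
          show ?case
            using divide_right_mono[OF elim tail_nonneg, of \<rho> "t j"] by (simp add: mult.commute)
        qed
      qed simp
    qed
  qed
  note up = upper_conv_pow[OF \<mu> this w0, of n, folded \<rho>]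
  show "1 \<le> w * (real n * rmgf \<gamma> \<mu> ^ (n - 1))"
  proof (rule dense_ge)
    fix C assume "w * (real n * rmgf \<gamma> \<mu> ^ (n - 1)) < C"
    from up[OF this] show "1 \<le> C"
      using upper_rho_ge_1 by (fastforce simp: upper_def)
  qed
qed

end

text \<open>The ratio is bounded, so every sequence tending to infinity has a subsequence along
  which it converges. The limit is always \<open>1 / ?N\<close>, independent of the
  sequence.\<close>

lemma ratio_tendsto:
  assumes \<mu>: "dominated \<mu>" and \<rho>: "\<rho> = conv_pow \<mu> n"
    and dec: "\<And>y e. 0 \<le> y \<Longrightarrow> 0 < e \<Longrightarrow>
      \<forall>\<^sub>F x in at_top. tail \<mu> (x + y) \<le> (1 + e) * (exp (- \<gamma> * y) * tail \<mu> x)"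
  obtains c where "0 < c" "((\<lambda>x. tail \<mu> x / tail \<rho> x) \<longlongrightarrow> c) at_top"
proof -
  let ?W = "\<lambda>x. tail \<mu> x / tail \<rho> x" and ?N = "real n * rmgf \<gamma> \<mu> ^ (n - 1)"
  obtain K where K: "0 \<le> K" "\<And>x. tail \<mu> x \<le> K * tail \<rho> x"
    using dominatedE[OF \<mu>] by blast
  have W: "norm (?W x) \<le> K" for x
    using K(2)[of x] tail_pos[of x] by (simp add: tail_nonneg field_simps)
  have sub: "\<exists>r. strict_mono r \<and> (\<lambda>j. ?W (t (r j))) \<longlonglongrightarrow> 1 / ?N \<and> 0 < 1 / ?N"
    if t: "filterlim t at_top sequentially" for t :: "nat \<Rightarrow> real"
  proof -
    have "bounded (range (\<lambda>j. ?W (t j)))"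
      using W by (auto simp: bounded_iff)
    then obtain w r where r: "strict_mono r" "(\<lambda>j. ?W (t (r j))) \<longlonglongrightarrow> w"
      using bounded_imp_convergent_subsequence[of "\<lambda>j. ?W (t j)"] by (auto simp: o_def)
    have "filterlim (\<lambda>j. t (r j)) at_top sequentially"
      using filterlim_compose[OF t filterlim_subseq[OF r(1)]] .
    then have w: "w * ?N = 1"
      by (rule ratio_limit_unique[OF _ \<mu> \<rho> dec r(2)])
    have "0 \<le> w"
      by (rule LIMSEQ_le_const[OF r(2)]) (auto simp: tail_nonneg)
    moreover have "w \<noteq> 0"
      using w by (metis mult_zero_left zero_neq_one)
    moreover have "?N \<noteq> 0"
      using w by (metis mult_zero_right zero_neq_one)
    then have "w = 1 / ?N"
      using w by (rule eq_divide_imp)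
    ultimately show ?thesis
      using r by (intro exI[of _ r]) (metis less_le)
  qed
  have "(?W \<longlongrightarrow> 1 / ?N) at_top"
  proof (rule tendsto_at_topI_sequentially)
    fix t :: "nat \<Rightarrow> real" assume t: "filterlim t at_top sequentially"
    show "(\<lambda>j. ?W (t j)) \<longlonglongrightarrow> 1 / ?N"
    proof (rule ccontr)
      \<comment> \<open>Otherwise infinitely many terms stay at distance at least e from
        \<open>1 / ?N\<close>. Enumerated by r they still run to infinity, so \<open>sub\<close>
        gives a further subsequence converging to \<open>1 / ?N\<close>.\<close>
      assume "\<not> (\<lambda>j. ?W (t j)) \<longlonglongrightarrow> 1 / ?N"
      then obtain e where e: "0 < e" "\<not> (\<forall>\<^sub>F j in sequentially. dist (?W (t j)) (1 / ?N) < e)"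
        by (auto simp: tendsto_iff)
      then have "\<exists>\<^sub>F j in sequentially. e \<le> dist (?W (t j)) (1 / ?N)"
        by (simp add: frequently_def not_le)
      then have "infinite {j. e \<le> dist (?W (t j)) (1 / ?N)}"
        by (simp add: frequently_cofinite[symmetric] cofinite_eq_sequentially)
      from infinite_enumerate[OF this]
      obtain r :: "nat \<Rightarrow> nat" where r: "strict_mono r" "\<forall>j. r j \<in> {j. e \<le> dist (?W (t j)) (1 / ?N)}"
        by blast
      obtain r' where "strict_mono r'" "(\<lambda>j. ?W (t (r (r' j)))) \<longlonglongrightarrow> 1 / ?N"
        using sub[OF filterlim_compose[OF t filterlim_subseq[OF r(1)]]] by blast
      then have "\<forall>\<^sub>F j in sequentially. dist (?W (t (r (r' j)))) (1 / ?N) < e"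
        using e(1) unfolding tendsto_iff by blast
      then obtain j where "dist (?W (t (r (r' j)))) (1 / ?N) < e"
        using eventually_happens'[OF sequentially_bot] by blast
      with r(2)[rule_format, of "r' j"] show False
        unfolding mem_Collect_eq by linarith
    qed
  qed
  moreover have "0 < 1 / ?N"
    \<comment> \<open>Positivity is part of \<open>sub\<close>; any sequence tending to infinity
      delivers it.\<close>
    using sub[OF filterlim_real_sequentially] by blast
  ultimately show thesis using that by blast
qed

text \<open>Tail equivalence with \<rho> gives \<mu> the exponential tail ratios of \<rho>. It also
  gives two-sided bounds with the same constant c at every shift, and these squeeze the tail of
  \<open>\<mu> \<star> \<mu>\<close>.\<close>

lemma class_S_of_ratio:
  assumes \<mu>: "dominated \<mu>" and c: "0 < c" "((\<lambda>x. tail \<mu> x / tail \<rho> x) \<longlongrightarrow> c) at_top"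
  shows "class_S \<gamma> \<mu>"
proof -
  have \<mu>': "real_distribution \<mu>" "integrable \<mu> (\<lambda>s. exp (\<gamma> * s))"
    using \<mu> by (auto simp: dominated_def)
  let ?M = "rmgf \<gamma> \<mu>"
  have M: "0 < ?M" "enn2real (mgf \<mu> \<gamma>) = ?M"
    using rmgf_pos[OF \<mu>'] by (simp_all add: mgf_eq_integral[OF \<mu>'(2)] rmgf_def)
  have \<rho>0: "tail \<rho> x \<noteq> 0" for x
    using tail_pos[of x] by simp
  have shifted: "((\<lambda>x. tail \<mu> (x + u) / tail \<rho> x) \<longlongrightarrow> c * exp (- \<gamma> * u)) at_top" for u
  proof -
    have "filterlim (\<lambda>x. x + u) at_top at_top"
      using filterlim_tendsto_add_at_top[OF tendsto_const filterlim_ident, of u] by (simp add: add.commute)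
    from tendsto_mult[OF filterlim_compose[OF c(2) this] tail_ratio[of u]]
    show ?thesis using \<rho>0 by simp
  qed
  have pos: "0 < tail \<mu> x" for x
  proof -
    have "\<forall>\<^sub>F y in at_top. 0 < tail \<mu> y / tail \<rho> y \<and> x \<le> y"
      using order_tendstoD(1)[OF c(2,1)] eventually_ge_at_top[of x] by (rule eventually_conj)
    then obtain y where "0 < tail \<mu> y / tail \<rho> y" "x \<le> y"
      using eventually_happens'[OF trivial_limit_at_top_linorder] by blast
    then have "0 < tail \<mu> y"
      using tail_pos[of y] by (simp add: zero_less_divide_iff)
    also have "\<dots> \<le> tail \<mu> x"
      using \<open>x \<le> y\<close> by (rule tail_antimono[OF \<mu>'(1)])
    finally show ?thesis .
  qed
  have L: "class_L \<gamma> \<mu>"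
    unfolding class_L_def asymp_eq_top_def
  proof (intro conjI allI pos)
    fix a
    have "((\<lambda>x. (tail \<mu> (x + a) / tail \<rho> x) / (exp (- \<gamma> * a) * (tail \<mu> x / tail \<rho> x)))
        \<longlongrightarrow> (c * exp (- \<gamma> * a)) / (exp (- \<gamma> * a) * c)) at_top"
      using c(1) by (intro tendsto_intros shifted c(2)) simp
    then show "((\<lambda>x. tail \<mu> (x + a) / (exp (- \<gamma> * a) * tail \<mu> x)) \<longlongrightarrow> 1) at_top"
      using c(1) \<rho>0 by simp
  qed
  have "((\<lambda>x. tail (\<mu> \<star> \<mu>) x / tail \<rho> x) \<longlongrightarrow> 2 * c * ?M) at_top"
  proof (rule tendsto_at_topI_sequentially)
    fix t :: "nat \<Rightarrow> real" assume t: "filterlim t at_top sequentially"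
    \<comment> \<open>With all shifts available, the convolution lemmas lose nothing in the set of
      shifts; the level m can go to infinity at the fixed shift 0.\<close>
    have low: "lower t \<mu> c UNIV" and up: "upper t \<mu> c UNIV"
      using filterlim_compose[OF shifted t] by (auto simp: lower_def upper_def tendsto_iff_asymp)
    obtain K where K: "0 \<le> K" "\<And>x. tail \<mu> x \<le> K * tail \<rho> x"
      using dominatedE[OF \<mu>] by blast
    have "asymp_ge (\<lambda>j. tail (\<mu> \<star> \<mu>) (t j) / tail \<rho> (t j)) (2 * c * ?M)"
    proof (rule asymp_ge_limit)
      show "asymp_ge (\<lambda>j. tail (\<mu> \<star> \<mu>) (t j) / tail \<rho> (t j)) (c * tmgf \<gamma> \<mu> (real m) + c * tmgf \<gamma> \<mu> (real m))" for m
        using lower_convolution[OF t \<mu>' \<mu>' low low, of UNIV "real m"]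
        by (auto simp: lower_def dest: spec[of _ 0])
      have "(\<lambda>m. c * tmgf \<gamma> \<mu> (real m) + c * tmgf \<gamma> \<mu> (real m)) \<longlonglongrightarrow> c * ?M + c * ?M"
        by (intro tendsto_intros tmgf_tendsto \<mu>')
      also have "c * ?M + c * ?M = 2 * c * ?M" by simp
      finally show "(\<lambda>m. c * tmgf \<gamma> \<mu> (real m) + c * tmgf \<gamma> \<mu> (real m)) \<longlonglongrightarrow> 2 * c * ?M" .
    qed
    moreover have "asymp_le (\<lambda>j. tail (\<mu> \<star> \<mu>) (t j) / tail \<rho> (t j)) (2 * c * ?M)"
    proof (rule asymp_le_limit)
      let ?g = "\<lambda>m. c * ?M + c * ?M + K * K * (2 * (rmgf \<gamma> \<rho> - tmgf \<gamma> \<rho> (real m)))"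
      show "asymp_le (\<lambda>j. tail (\<mu> \<star> \<mu>) (t j) / tail \<rho> (t j)) (?g m)" for m
        using upper_convolution[OF t \<mu> \<mu> K(2,1) K(2,1) up up, of UNIV "real m"] c(1)
        by (auto simp: upper_def dest: spec[of _ 0])
      have "?g \<longlonglongrightarrow> c * ?M + c * ?M + K * K * (2 * (rmgf \<gamma> \<rho> - rmgf \<gamma> \<rho>))"
        by (intro tendsto_intros tmgf_tendsto rho exp_integrable)
      also have "c * ?M + c * ?M + K * K * (2 * (rmgf \<gamma> \<rho> - rmgf \<gamma> \<rho>)) = 2 * c * ?M" by simp
      finally show "?g \<longlonglongrightarrow> 2 * c * ?M" .
    qed
    ultimately show "(\<lambda>j. tail (\<mu> \<star> \<mu>) (t j) / tail \<rho> (t j)) \<longlonglongrightarrow> 2 * c * ?M"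
      by (simp add: tendsto_iff_asymp)
  qed
  then have "((\<lambda>x. (tail (\<mu> \<star> \<mu>) x / tail \<rho> x) / (2 * ?M * (tail \<mu> x / tail \<rho> x)))
      \<longlongrightarrow> (2 * c * ?M) / (2 * ?M * c)) at_top"
    using c M by (intro tendsto_intros) auto
  then have "((\<lambda>x. tail (\<mu> \<star> \<mu>) x / (2 * ?M * tail \<mu> x)) \<longlongrightarrow> 1) at_top"
    using c(1) M(1) \<rho>0 by simp
  then show ?thesis
    using L \<mu>' unfolding class_S_def conv_pow_2[OF \<mu>'(1)] M asymp_eq_top_def
    by (simp add: integrable_exp_iff)
qed

end

section \<open>Assembly, with the n-th convolution power of \<mu> as reference distribution\<close>

theorem theorem1p2:
  fixes \<gamma> :: real and \<mu> :: "real measure" and n :: nat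
  assumes "\<gamma> > 0"
    and "real_distribution \<mu>"
    and "fun_M (\<lambda>x. exp (\<gamma> * x) * tail \<mu> x)"
    and "n \<ge> 1"
    and "class_S \<gamma> (conv_pow \<mu> n)"
  shows "class_S \<gamma> \<mu>"
proof -
  let ?\<rho> = "conv_pow \<mu> n"
  have \<rho>: "real_distribution ?\<rho>"
    by (rule real_distribution_conv_pow[OF assms(2)])
  interpret convolution_equivalent ?\<rho> \<gamma>
    using \<rho> assms(5) by (simp add: convolution_equivalent_def convolution_equivalent_axioms_def)
  obtain k where n: "n = Suc k"
    using assms(4) by (cases n) auto
  \<comment> \<open>The moment of the n-th power is the n-th power of the moment, and n is positive,
    so finiteness passes to \<mu>.\<close>
  have "mgf \<mu> \<gamma> ^ n < \<infinity>"
    using assms(5) by (simp add: class_S_def mgf_conv_pow[OF assms(2)])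
  then have exp: "integrable \<mu> (\<lambda>s. exp (\<gamma> * s))"
    using n by (auto simp: integrable_exp_iff[OF assms(2)] less_top[symmetric] ennreal_top_eq_mult_iff
        power_eq_top_ennreal)
  \<comment> \<open>Writing n = Suc k exhibits \<mu> as a convolution factor of the reference
    distribution.\<close>
  have \<mu>: "dominated \<mu>"
    by (rule dominated_factor[OF assms(2) exp real_distribution_conv_pow[OF assms(2), of k]])
      (simp add: n)
  have dec: "\<forall>\<^sub>F x in at_top. tail \<mu> (x + y) \<le> (1 + e) * (exp (- \<gamma> * y) * tail \<mu> x)"
    if "0 \<le> y" "0 < e" for y e
    using fun_M_almost_decreasing[OF assms(3) that]
  proof eventually_elim
    case (elim x)
    \<comment> \<open>Multiplying by exp (- \<gamma> * (x + y)) turns the almost monotonicity of the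
      weighted tail into a statement on the tail alone.\<close>
    have "exp (- \<gamma> * (x + y)) * (exp (\<gamma> * (x + y)) * tail \<mu> (x + y))
        \<le> exp (- \<gamma> * (x + y)) * ((1 + e) * (exp (\<gamma> * x) * tail \<mu> x))"
      using elim by (intro mult_left_mono) auto
    moreover have "exp (- \<gamma> * (x + y)) * (exp (\<gamma> * (x + y)) * tail \<mu> (x + y)) = tail \<mu> (x + y)"
      by (simp add: mult.assoc[symmetric] exp_add[symmetric])
    moreover have "exp (- \<gamma> * (x + y)) * exp (\<gamma> * x) = exp (- \<gamma> * y)"
      by (simp add: exp_add[symmetric] algebra_simps)
    ultimately show ?case
      by (metis mult.assoc mult.left_commute)
  qed
  obtain c where "0 < c" "((\<lambda>x. tail \<mu> x / tail ?\<rho> x) \<longlongrightarrow> c) at_top"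
    using ratio_tendsto[OF \<mu> refl dec] by blast
  then show ?thesis
    by (rule class_S_of_ratio[OF \<mu>])
qed

end
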